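(* Consider the power network model described in the context (linearized power flows), and suppose that each $f_i$ is continuously differentiable and there exist constants $\mu>0$ and $L>0$ such that for all $i\in\mathcal N$ and all $w\in\mathbb R$, $$-L\le \frac{1}{M_i}\frac{d f_i(w)}{dw}\le -\mu .$$ Let $(\theta(t),\omega(t))$ be the solution of the nodal dynamics from an arbitrary initial state $(\theta(0),\omega(0))$ and let $\omega_b(t)$ be the solution of the blended dynamics. Define $$K:=\frac{32\,N M_b\,(1+\frac{L}{\mu})^2}{(\min_{i\in\mathcal N}M_i)\,\mu^2},\qquad c:=\frac{\mu\lambda_2}{4(\lambda_2+4L^2)} .$$ Then: (1) If $C:=\max_{i\in\mathcal N}\sup_{t>0}|\dot\xi_i(t)|/M_i$ is finite, then there exists a positive constant $\alpha$ such that for all $t>0$, $$\max_{i\in\mathcal N}|\omega_i(t)-\omega_b(t)|^2\le \alpha e^{-ct}+K C^2\frac{(\lambda_2+4L^2)^2}{\lambda_2^3}.$$ (2) If $C_{\lim}:=\max_{i\in\mathcal N}\limsup_{t\to\infty}|\dot\xi_i(t)|/M_i$ is finite, then $$\max_{i\in\mathcal N}\limsup_{t\to\infty}|\omega_i(t)-\omega_b(t)|^2\le K C_{\lim}^2\frac{(\lambda_2+4L^2)^2}{\lambda_2^3}.$$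
   Context: Let $(\mathcal N,\mathcal E)$ be a connected undirected graph with node set $\mathcal N=\{1,\dots,N\}$; $\mathcal N_i$ denotes the set of neighbors of node $i$. Each node $i$ has an inertia constant $M_i>0$ and a function $f_i:\mathbb R\to\mathbb R$ with $f_i(0)=0$; each edge $\{i,j\}$ has a weight $B_{ij}=B_{ji}>0$. The disturbances $\xi_i(t)$ are real-valued signals that are continuously differentiable on $(0,\infty)$ and may have a finite jump at $t=0$: $\xi_i(0_-)$ denotes the value before time $0$ and $\xi_i(0_+)=\lim_{t\to0^+}\xi_i(t)$. The nodal (swing) dynamics with linearized power flow are $$\dot\theta_i=\omega_i,\qquad M_i\dot\omega_i=f_i(\omega_i)+\xi_i(t)-\sum_{j\in\mathcal N_i}B_{ij}(\theta_i-\theta_j),\quad i\in\mathcal N.$$ Set $M=\mathrm{diag}(M_1,\dots,M_N)$, $M_b=\frac1N\sum_i M_i$, $f_b(w)=\frac1N\sum_i f_i(w)$, $\xi_b(t)=\frac1N\sum_i\xi_i(t)$. The blended dynamics is the scalar ODE $M_b\dot\omega_b=f_b(\omega_b)+\xi_b(t)$ with $\omega_b(0)=\sum_iM_i\omega_i(0)/\sum_iM_i$. $L_B$ is the weighted Laplacian with $(L_B)_{ij}=-B_{ij}$ for $i\ne j$ adjacent (0 if not adjacent) and $(L_B)_{ii}=\sum_{j\ne i}B_{ij}$; $\lambda_2$ denotes the second-smallest eigenvalue of $M^{-1}L_B$. Statements "for $t>0$" start from $t=0_+$. *)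

theory Defs
  imports "HOL-Analysis.Analysis" "HOL-Computational_Algebra.Polynomial"
begin

text \<open>Weighted Laplacian of the edge weights B (B i j = 0 for non-adjacent i, j).\<close>
definition laplacian :: "('n::finite \<Rightarrow> 'n \<Rightarrow> real) \<Rightarrow> real^'n^'n" where
  "laplacian B = (\<chi> i j. if i = j then (\<Sum>k\<in>UNIV - {i}. B i k) else - B i j)"

definition scaled_laplacian :: "('n::finite \<Rightarrow> real) \<Rightarrow> ('n \<Rightarrow> 'n \<Rightarrow> real) \<Rightarrow> real^'n^'n" where
  "scaled_laplacian M B = (\<chi> i j. (laplacian B $ i $ j) / M i)"

definition charpoly :: "real^'n::finite^'n \<Rightarrow> real poly" where
  "charpoly A = det (\<chi> i j. (if i = j then [:0, 1:] else 0) - [:A $ i $ j:])"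

definition second_smallest_eigenvalue :: "real^'n::finite^'n \<Rightarrow> real" where
  "second_smallest_eigenvalue A =
     (LEAST lam. 2 \<le> (\<Sum>mu\<in>{mu. poly (charpoly A) mu = 0 \<and> mu \<le> lam}. order mu (charpoly A)))"

end

theory Submission
  imports Defs
begin

text \<open>
  Split \<open>omega i - omega_b\<close> into the deviation of \<open>omega i\<close> from the \<open>M\<close>-weighted mean frequency and
  the offset of that mean from \<open>omega_b\<close>. Differentiating the swing equation once more shows that the
  frequencies obey \<open>M omega'' = f'(omega) omega' - L_B omega + xi'\<close>, an oscillator with damping between
  \<open>mu\<close> and \<open>L\<close> and bounded forcing; its energy plus a small multiple of
  \<open>\<langle>deviation, omega'\<rangle>\<close> is a Lyapunov function that controls the deviation through the spectral gap
  \<open>lam2\<close>. The flows cancel in the equation of the mean, so the offset is driven only by the deviation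
  and is damped at rate \<open>mu\<close>.
\<close>

section \<open>Second smallest eigenvalue\<close>

text \<open>The flows are linear in the angles, whose derivative is \<open>omega\<close>, so one
  differentiation eliminates the angles and leaves \<open>xi'\<close> as forcing: the bounds see how
  fast the disturbance varies, not its size. The plain energy loses only acceleration, since damping
  gives no decay of the coupling part; the cross term supplies that decay. Its weight must keep the
  function comparable to the energy and must be paid for by the damping \<open>mu\<close>, including
  a cost \<open>L\<^sup>2 / lam2\<close> of the damping inside the cross term; this shapes
  \<open>rate\<close>. In \<open>K\<close>, the factor 32 is 4 * 2 * 4: recovering the energy from
  the Lyapunov function, the forcing cost \<open>2 / mu\<close>, and the 4 in
  \<open>1 / rate\<close>. The factor \<open>(1 + L / mu)\<^sup>2\<close> comes from adding to the
  deviation an offset whose bound is \<open>L / mu\<close> times as large. On the spectral side the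
  obstacle is that the eigenvalue is defined by counting roots of the characteristic polynomial with
  multiplicity: algebraic simplicity of the root 0 must be proved before \<open>lam2\<close> becomes
  the least positive root.\<close>

lemma poly_det: "poly (det P) x = det (\<chi> i j. poly (P $ i $ j) x)"
  for P :: "'a::comm_ring_1 poly^'n::finite^'n"
  by (simp add: det_def poly_sum poly_prod poly_mult)

lemma poly_charpoly: "poly (charpoly A) x = det (mat x - A)"
  unfolding charpoly_def poly_det
  by (rule arg_cong[where f = det]) (simp add: vec_eq_iff mat_def)

lemma det_eq_0_iff_kernel: "det A = 0 \<longleftrightarrow> (\<exists>v. v \<noteq> 0 \<and> A *v v = 0)"
  for A :: "real^'n::finite^'n"
  by (metis invertible_det_nz invertible_left_inverse matrix_left_invertible_ker)

lemma poly_charpoly_eq_0_iff: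
  "poly (charpoly A) x = 0 \<longleftrightarrow> (\<exists>v. v \<noteq> 0 \<and> A *v v = x *s v)"
  for A :: "real^'n::finite^'n"
proof -
  have "mat x *v v = x *s v" for v :: "real^'n"
    by (simp add: vec_eq_iff matrix_vector_mult_def mat_def if_distrib if_distribR cong: if_cong)
  then show ?thesis
    by (auto simp: poly_charpoly det_eq_0_iff_kernel matrix_vector_mult_diff_rdistrib)
qed

text \<open>Adding all columns of \<open>X - A\<close> to column \<open>k\<close> turns that column into \<open>X\<close> times the all-ones
  vector, so one factor \<open>X\<close> splits off.\<close>
lemma order_0_charpoly:
  fixes A :: "real^'n::finite^'n"
  assumes row_sum: "\<And>i. (\<Sum>j\<in>UNIV. A $ i $ j) = 0"
    and nonsing: "\<And>v c. A *v v = (\<chi> i. c) \<Longrightarrow> v $ k = 0 \<Longrightarrow> v = 0"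
  shows "order 0 (charpoly A) = 1" and "charpoly A \<noteq> 0"
proof -
  define P :: "real poly^'n^'n"
    where "P = (\<chi> i j. (if i = j then [:0, 1:] else 0) - [:A $ i $ j:])"
  \<comment> \<open>Transposing turns the column operation into a row operation, the form in which
    \<open>det_linear_row_sum\<close> and \<open>det_identical_rows\<close> apply.\<close>
  define R where "R = transpose P"
  define Q :: "real poly^'n^'n" where "Q = (\<chi> r. if r = k then 1 else R $ r)"
  have "charpoly A = det R"
    by (simp add: charpoly_def P_def R_def det_transpose)
  also have "\<dots> = det (\<chi> r. if r = k then (\<Sum>j\<in>UNIV. R $ j) else R $ r)"
  proof -
    have "det (\<chi> r. if r = k then (\<Sum>j\<in>UNIV. R $ j) else R $ r)
        = (\<Sum>j\<in>UNIV. det (\<chi> r. if r = k then R $ j else R $ r))"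
      using det_linear_row_sum[of UNIV k "\<lambda>_ j. R $ j" "\<lambda>r. R $ r"] by simp
    also have "\<dots> = (\<Sum>j\<in>UNIV. if j = k then det R else 0)"
    proof (rule sum.cong[OF refl])
      fix j
      show "det (\<chi> r. if r = k then R $ j else R $ r) = (if j = k then det R else 0)"
      proof (cases "j = k")
        case True
        then have "(\<chi> r. if r = k then R $ j else R $ r) = R"
          by (simp add: vec_eq_iff)
        with True show ?thesis by simp
      next
        case False
        then show ?thesis
          using det_identical_rows[of j k "\<chi> r. if r = k then R $ j else R $ r"]
          by (simp add: row_def vec_eq_iff)
      qed
    qed
    finally show ?thesis by simp
  qed
  also have "(\<chi> r. if r = k then (\<Sum>j\<in>UNIV. R $ j) else R $ r)
      = (\<chi> r. if r = k then [:0, 1:] *s 1 else R $ r)"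
  proof -
    have "(\<Sum>j\<in>UNIV. R $ j) $ i = [:0, 1:]" for i
    proof -
      have "(\<Sum>j\<in>UNIV. [:A $ i $ j:]) = [:\<Sum>j\<in>UNIV. A $ i $ j:]"
        by (simp add: poly_eq_iff coeff_sum coeff_pCons split: nat.split)
      then show ?thesis
        by (simp add: R_def P_def transpose_def sum_subtractf row_sum)
    qed
    then show ?thesis by (simp add: vec_eq_iff)
  qed
  also have "det \<dots> = [:0, 1:] * det Q"
    unfolding Q_def by (rule det_row_mul)
  finally have fact: "charpoly A = [:0, 1:] * det Q" .
  \<comment> \<open>The cofactor of X must not vanish at 0. A kernel vector \<open>v\<close> of the
    transposed matrix at 0, with its \<open>k\<close>-th coordinate moved to the other side, yields
    a \<open>w\<close> that vanishes at \<open>k\<close> and is sent by \<open>A\<close> to a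
    constant vector, against \<open>nonsing\<close>.\<close>
  have "poly (det Q) 0 \<noteq> 0"
  proof
    assume "poly (det Q) 0 = 0"
    define Q0 :: "real^'n^'n" where "Q0 = (\<chi> i j. if j = k then 1 else - A $ i $ j)"
    have "(\<chi> i j. poly (Q $ i $ j) 0) = transpose Q0"
      by (simp add: vec_eq_iff Q_def R_def P_def Q0_def transpose_def)
    with \<open>poly (det Q) 0 = 0\<close> have "det Q0 = 0"
      by (simp add: poly_det det_transpose)
    then obtain v where v: "v \<noteq> 0" "Q0 *v v = 0"
      by (auto simp: det_eq_0_iff_kernel)
    define w where "w = (\<chi> i. if i = k then 0 else v $ i)"
    have "A *v w = (\<chi> i. v $ k)"
    proof -
      have "(A *v w) $ i = v $ k" for i
      proof -
        have "0 = (\<Sum>j\<in>UNIV. Q0 $ i $ j * v $ j)"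
          using v(2) by (simp add: vec_eq_iff matrix_vector_mult_def)
        also have "\<dots> = (\<Sum>j\<in>UNIV. (if j = k then v $ k else 0) - A $ i $ j * w $ j)"
          by (rule sum.cong) (auto simp: Q0_def w_def)
        finally show ?thesis
          by (simp add: sum_subtractf matrix_vector_mult_def)
      qed
      then show ?thesis by (simp add: vec_eq_iff)
    qed
    moreover from this have "w = 0"
      by (rule nonsing) (simp add: w_def)
    ultimately have "v $ k = 0"
      by (simp add: vec_eq_iff matrix_vector_mult_def)
    with \<open>w = 0\<close> have "v = 0"
      by (auto simp: w_def vec_eq_iff) metis
    with v(1) show False by simp
  qed
  then have "det Q \<noteq> 0" and "order 0 (det Q) = 0"
    by (auto simp: order_root)
  moreover have "order 0 [:0, 1 :: real:] = 1"
    using order_power_n_n[of "0::real" 1] by simp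
  ultimately show "charpoly A \<noteq> 0" and "order 0 (charpoly A) = 1"
    unfolding fact using order_mult[of "[:0, 1:]" "det Q" 0] by auto
qed

text \<open>No root is negative and 0 counts exactly once, so the multiplicity count first reaches 2
  at the smallest positive root. The root \<open>nu\<close> only ensures that the minimum is over a
  nonempty set.\<close>

lemma second_smallest_eigenvalue_eq_Min:
  fixes A :: "real^'n::finite^'n"
  defines "Z \<equiv> {x. poly (charpoly A) x = 0}"
  assumes nz: "charpoly A \<noteq> 0" and order: "order 0 (charpoly A) = 1"
    and nonneg: "\<And>x. x \<in> Z \<Longrightarrow> 0 \<le> x" and nu: "nu \<in> Z" "nu \<noteq> 0"
  shows "second_smallest_eigenvalue A = Min (Z - {0})"
  unfolding second_smallest_eigenvalue_def
proof (rule Least_equality)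
  have fin: "finite Z"
    unfolding Z_def by (rule poly_roots_finite[OF nz])
  have mem: "Min (Z - {0}) \<in> Z - {0}"
    using nu fin by (intro Min_in) auto
  have "0 \<in> Z"
    using order nz by (simp add: Z_def order_root)
  let ?l = "Min (Z - {0})"
  let ?R = "\<lambda>l. {x. poly (charpoly A) x = 0 \<and> x \<le> l}"
  have finR: "finite (?R l)" for l
    by (rule finite_subset[OF _ fin]) (auto simp: Z_def)
  have "order ?l (charpoly A) \<ge> 1"
    using mem nz order_root[of "charpoly A" ?l] by (simp add: Z_def Suc_le_eq)
  then have "2 \<le> (\<Sum>x\<in>{0, ?l}. order x (charpoly A))"
    using mem order by auto
  also have "\<dots> \<le> (\<Sum>x\<in>?R ?l. order x (charpoly A))"
    using mem nonneg \<open>0 \<in> Z\<close> finR by (intro sum_mono2) (auto simp: Z_def)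
  finally show "2 \<le> (\<Sum>x\<in>?R ?l. order x (charpoly A))" .
  fix y
  assume y: "2 \<le> (\<Sum>x\<in>?R y. order x (charpoly A))"
  show "?l \<le> y"
  proof (rule ccontr)
    assume "\<not> ?l \<le> y"
    then have "\<not> x \<le> y" if "x \<in> Z - {0}" for x
      using that Min_le[of "Z - {0}" x] fin by (meson finite_Diff order_trans)
    then have "?R y \<subseteq> {0}" by (auto simp: Z_def)
    then have "(\<Sum>x\<in>?R y. order x (charpoly A)) \<le> (\<Sum>x\<in>{0}. order x (charpoly A))"
      by (intro sum_mono2) auto
    with y order show False by simp
  qed
qed

section \<open>Real inequalities\<close>

text \<open>The first-order condition at a minimum, used below for variations of the Rayleigh
  quotient.\<close>

lemma linear_coeff_eq_0:
  fixes l k :: real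
  assumes "\<And>s. 0 \<le> 2 * s * l + s\<^sup>2 * k"
  shows "l = 0"
proof -
  \<comment> \<open>Minimizer of the quadratic with \<open>k\<close> replaced by the larger and
    surely positive \<open>\<bar>k\<bar> + 1\<close>.\<close>
  let ?s = "- l / (\<bar>k\<bar> + 1)"
  have "0 \<le> 2 * ?s * l + ?s\<^sup>2 * k"
    by (rule assms)
  also have "\<dots> \<le> 2 * ?s * l + ?s\<^sup>2 * (\<bar>k\<bar> + 1)"
    by (intro add_left_mono mult_left_mono) auto
  also have "\<dots> = - (l\<^sup>2 / (\<bar>k\<bar> + 1))"
    by (simp add: power2_eq_square add_pos_nonneg)
  finally have "l\<^sup>2 / (\<bar>k\<bar> + 1) \<le> 0" by simp
  then have "l\<^sup>2 \<le> 0"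
    by (meson abs_ge_zero add_nonneg_pos divide_pos_pos not_le zero_less_one)
  then show ?thesis by simp
qed

text \<open>Subtracting the equilibrium \<open>b / a\<close> and a multiple \<beta> of the
  exponential that absorbs the \<open>D\<close> term leaves a quantity whose product with
  \<open>exp (a * t)\<close> is nonincreasing. The condition on \<beta> covers both uses:
  \<open>c = a\<close> with \<open>D = 0\<close>, and \<open>c < a\<close> with an exponentially
  decaying input.\<close>

lemma gronwall_decay:
  fixes g g' :: "real \<Rightarrow> real"
  assumes deriv: "\<And>t. t \<ge> T \<Longrightarrow> (g has_real_derivative g' t) (at t)"
    and le: "\<And>t. t \<ge> T \<Longrightarrow> g' t \<le> - a * g t + b + D * exp (- c * t)"
    and "0 < c" "c \<le> a" "D \<le> \<beta> * (a - c)" "0 \<le> T"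
  shows "\<exists>\<alpha>\<ge>0. \<forall>t\<ge>T. g t \<le> \<alpha> * exp (- c * t) + b / a"
proof -
  define h where "h t = (g t - b / a - \<beta> * exp (- c * t)) * exp (a * t)" for t
  have "a > 0" using assms by simp
  have dec: "h t \<le> h T" if "t \<ge> T" for t
  proof (rule DERIV_nonpos_imp_nonincreasing[OF that])
    fix s assume "T \<le> s" "s \<le> t"
    let ?h' = "(g' s + a * g s - b - \<beta> * (a - c) * exp (- c * s)) * exp (a * s)"
    have "(h has_real_derivative ?h') (at s)"
      unfolding h_def using \<open>a > 0\<close>
      by (auto intro!: derivative_eq_intros deriv[OF \<open>T \<le> s\<close>] simp: field_simps)
    moreover have "?h' \<le> 0"
    proof -
      have "D * exp (- c * s) \<le> \<beta> * (a - c) * exp (- c * s)"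
        using assms by (intro mult_right_mono) auto
      then have "g' s + a * g s - b - \<beta> * (a - c) * exp (- c * s) \<le> 0"
        using le[OF \<open>T \<le> s\<close>] by linarith
      then show ?thesis
        by (rule mult_nonpos_nonneg) simp
    qed
    ultimately show "\<exists>y. (h has_real_derivative y) (at s) \<and> y \<le> 0" by blast
  qed
  show ?thesis
  proof (intro exI[of _ "\<bar>h T\<bar> + \<bar>\<beta>\<bar>"] conjI allI impI)
    fix t assume "t \<ge> T"
    have "h T * exp (- a * t) \<le> \<bar>h T\<bar> * exp (- c * t)"
      using assms \<open>t \<ge> T\<close> by (intro mult_mono) (auto intro: mult_right_mono)
    moreover have "g t - b / a - \<beta> * exp (- c * t) = h t * exp (- a * t)"
      by (simp add: h_def mult.assoc flip: exp_add)
    moreover have "h t * exp (- a * t) \<le> h T * exp (- a * t)"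
      using dec[OF \<open>t \<ge> T\<close>] by (intro mult_right_mono) auto
    moreover have "\<beta> * exp (- c * t) \<le> \<bar>\<beta>\<bar> * exp (- c * t)"
      by (intro mult_right_mono) auto
    ultimately show "g t \<le> (\<bar>h T\<bar> + \<bar>\<beta>\<bar>) * exp (- c * t) + b / a"
      unfolding distrib_right by linarith
  qed simp
qed

text \<open>Young's inequality. The weight \<open>k\<close> is chosen at each use so that one square
  is absorbed by available dissipation.\<close>

lemma mult_le_weighted_squares:
  fixes x y k :: real
  assumes "k > 0"
  shows "x * y \<le> k * x\<^sup>2 + y\<^sup>2 / (4 * k)"
proof -
  have "0 \<le> (2 * k * x - y)\<^sup>2 / (4 * k)"
    using assms by simp
  also have "\<dots> = k * x\<^sup>2 + y\<^sup>2 / (4 * k) - x * y"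
    using assms by (simp add: field_simps power2_eq_square)
  finally show ?thesis by simp
qed

section \<open>Weighted networks\<close>

locale weighted_network =
  fixes M :: "'n::finite \<Rightarrow> real" and B :: "'n \<Rightarrow> 'n \<Rightarrow> real"
  assumes card_ge_2: "CARD('n) \<ge> 2"
    and M_pos: "M i > 0"
    and B_sym: "B i j = B j i"
    and B_nonneg: "B i j \<ge> 0"
    and connected: "(i, j) \<in> {(i, j). B i j > 0}\<^sup>*"
begin

section \<open>Inertia-weighted inner product and Dirichlet form of the graph\<close>

definition ip :: "('n \<Rightarrow> real) \<Rightarrow> ('n \<Rightarrow> real) \<Rightarrow> real" where
  "ip x y = (\<Sum>i\<in>UNIV. M i * x i * y i)"

text \<open>The bilinear form of the Laplacian, written over ordered pairs: every edge occurs twice,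
  hence the division by 2.\<close>

definition dform :: "('n \<Rightarrow> real) \<Rightarrow> ('n \<Rightarrow> real) \<Rightarrow> real" where
  "dform x y = (\<Sum>i\<in>UNIV. \<Sum>j\<in>UNIV. B i j * (x i - x j) * (y i - y j)) / 2"

text \<open>Summation by parts: exchanging the two indices and using symmetry of \<open>B\<close>
  turns the \<open>y j\<close> half of the double sum into the negative of the \<open>y i\<close>
  half.\<close>

lemma dform_eq: "dform x y = (\<Sum>i\<in>UNIV. y i * (\<Sum>j\<in>UNIV. B i j * (x i - x j)))"
proof -
  let ?S = "\<Sum>i\<in>UNIV. \<Sum>j\<in>UNIV. B i j * (x i - x j) * y i"
  have "(\<Sum>i\<in>UNIV. \<Sum>j\<in>UNIV. B i j * (x i - x j) * y j)
      = (\<Sum>j\<in>UNIV. \<Sum>i\<in>UNIV. B i j * (x i - x j) * y j)"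
    by (rule sum.swap)
  also have "\<dots> = - ?S"
    unfolding sum_negf[symmetric]
  proof (intro sum.cong refl)
    fix i j
    show "B j i * (x j - x i) * y i = - (B i j * (x i - x j) * y i)"
      using B_sym[of i j] by (simp add: algebra_simps)
  qed
  finally have "dform x y = ?S"
    by (simp add: dform_def right_diff_distrib sum_subtractf)
  then show ?thesis
    by (simp add: sum_distrib_left mult_ac)
qed

lemma dform_const [simp]: "dform x (\<lambda>_. c) = 0"
  by (simp add: dform_def)

lemma sum_flow_eq_0: "(\<Sum>i\<in>UNIV. \<Sum>j\<in>UNIV. B i j * (x i - x j)) = 0"
  using dform_eq[of x "\<lambda>_. 1"] by simp

lemma dform_self_nonneg: "dform x x \<ge> 0"
  unfolding dform_def using B_nonneg by (auto intro!: sum_nonneg simp: mult.assoc)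

lemma ip_self_nonneg: "ip x x \<ge> 0"
  unfolding ip_def using M_pos by (auto intro!: sum_nonneg simp: mult.assoc less_imp_le)

lemma ip_self_pos: "x i \<noteq> 0 \<Longrightarrow> ip x x > 0"
  unfolding ip_def using M_pos
  by (intro sum_pos2[of UNIV i]) (auto simp: mult.assoc less_imp_le zero_less_mult_iff not_less linorder_neq_iff)

text \<open>Each nonnegative summand vanishes, which equates \<open>x\<close> across every edge;
  connectedness then propagates this along paths.\<close>

lemma dform_self_eq_0D:
  assumes "dform x x = 0"
  shows "x i = x j"
proof -
  have nn: "0 \<le> B i j * (x i - x j) * (x i - x j)" for i j
    using B_nonneg by (simp add: mult.assoc)
  have "(\<Sum>i\<in>UNIV. \<Sum>j\<in>UNIV. B i j * (x i - x j) * (x i - x j)) = 0"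
    using assms by (simp add: dform_def)
  then have "(\<Sum>j\<in>UNIV. B i j * (x i - x j) * (x i - x j)) = 0" for i
    using nn by (subst (asm) sum_nonneg_eq_0_iff) (auto intro: sum_nonneg)
  then have "B i j * (x i - x j) * (x i - x j) = 0" for i j
    using nn by (subst (asm) sum_nonneg_eq_0_iff) auto
  then have edge: "x i = x j" if "B i j > 0" for i j
    using that by (metis eq_iff_diff_eq_0 less_irrefl mult_eq_0_iff)
  from connected[of i j] show ?thesis
    by (induction rule: rtrancl_induct) (auto dest: edge)
qed

section \<open>Spectrum of the scaled Laplacian\<close>

lemma scaled_laplacian_mult:
  "(scaled_laplacian M B *v x) $ i = (\<Sum>j\<in>UNIV. B i j * (x $ i - x $ j)) / M i"
proof -
  have "(\<Sum>j\<in>UNIV. laplacian B $ i $ j * x $ j)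
      = (\<Sum>k\<in>UNIV - {i}. B i k) * x $ i - (\<Sum>j\<in>UNIV - {i}. B i j * x $ j)"
    by (subst sum.remove[of _ i])
       (auto simp: laplacian_def sum_negf[symmetric] intro!: sum.cong)
  also have "\<dots> = (\<Sum>j\<in>UNIV - {i}. B i j * (x $ i - x $ j))"
    by (simp add: sum_distrib_right sum_subtractf right_diff_distrib)
  also have "\<dots> = (\<Sum>j\<in>UNIV. B i j * (x $ i - x $ j))"
    by (rule sum.mono_neutral_left) auto
  finally show ?thesis
    by (simp add: matrix_vector_mult_def scaled_laplacian_def flip: sum_divide_distrib)
qed

text \<open>The weight \<open>M i\<close> cancels the row scaling, so the non-symmetric matrix is
  self-adjoint for \<open>ip\<close>; this is why masses weight the inner product.\<close>

lemma ip_scaled_laplacian: "ip (($) (scaled_laplacian M B *v x)) y = dform (($) x) y"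
proof -
  have "M i * ((\<Sum>j\<in>UNIV. B i j * (x $ i - x $ j)) / M i) * y i
      = y i * (\<Sum>j\<in>UNIV. B i j * (x $ i - x $ j))" for i
    using M_pos[of i] by simp
  then show ?thesis
    unfolding ip_def dform_eq scaled_laplacian_mult by (simp only:)
qed

definition total :: real where "total = (\<Sum>i\<in>UNIV. M i)"

lemma total_pos: "total > 0"
  unfolding total_def using M_pos by (intro sum_pos) auto

lemma order_0_charpoly_scaled_laplacian:
  "order 0 (charpoly (scaled_laplacian M B)) = 1" "charpoly (scaled_laplacian M B) \<noteq> 0"
proof -
  fix k :: 'n
  have row: "(\<Sum>j\<in>UNIV. scaled_laplacian M B $ i $ j) = 0" for i
    using scaled_laplacian_mult[of "\<chi> i. 1" i] by (simp add: matrix_vector_mult_def)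
  have nonsing: "v = 0"
    if v: "scaled_laplacian M B *v v = (\<chi> i. c)" "v $ k = 0" for v c
  proof -
    \<comment> \<open>Pairing with the constants kills the Laplacian side, so a constant vector in
      the range must be zero.\<close>
    have "c * total = ip (($) (scaled_laplacian M B *v v)) (\<lambda>_. 1)"
      by (simp add: v ip_def total_def sum_distrib_left mult.commute)
    then have "c = 0"
      using total_pos by (simp add: ip_scaled_laplacian)
    have "dform (($) v) (($) v) = 0"
      unfolding ip_scaled_laplacian[symmetric] by (simp add: v \<open>c = 0\<close> ip_def)
    then have "v $ i = v $ k" for i
      by (rule dform_self_eq_0D)
    with v show ?thesis by (simp add: vec_eq_iff)
  qed
  show "order 0 (charpoly (scaled_laplacian M B)) = 1" "charpoly (scaled_laplacian M B) \<noteq> 0"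
    using order_0_charpoly[of "scaled_laplacian M B" k] row nonsing by auto
qed

lemma scaled_laplacian_eigenvalue_nonneg:
  assumes "poly (charpoly (scaled_laplacian M B)) x = 0"
  shows "0 \<le> x"
proof -
  obtain v where v: "v \<noteq> 0" "scaled_laplacian M B *v v = x *s v"
    using assms poly_charpoly_eq_0_iff by blast
  then obtain i where "v $ i \<noteq> 0"
    by (auto simp: vec_eq_iff)
  then have "ip (($) v) (($) v) > 0"
    by (rule ip_self_pos)
  moreover have "x * ip (($) v) (($) v) = dform (($) v) (($) v)"
    unfolding ip_scaled_laplacian[symmetric] v
    by (simp add: ip_def sum_distrib_left mult_ac)
  ultimately show ?thesis
    using dform_self_nonneg[of "($) v"] by (metis mult_less_0_iff not_le)
qed

text \<open>Minimizing the Rayleigh quotient over the \<open>M\<close>-orthogonal complement of the constants yields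
  a positive eigenvalue of the scaled Laplacian.\<close>
lemma rayleigh_minimum:
  obtains nu where "nu > 0" "poly (charpoly (scaled_laplacian M B)) nu = 0"
    "\<And>x. ip x (\<lambda>_. 1) = 0 \<Longrightarrow> nu * ip x x \<le> dform x x"
proof -
  let ?A = "scaled_laplacian M B"
  \<comment> \<open>The Rayleigh quotient is scale invariant, so the Euclidean sphere serves as the
    compact set even though the quotient is taken with respect to \<open>ip\<close>.\<close>
  define K where "K = {x :: real^'n. ip (($) x) (\<lambda>_. 1) = 0} \<inter> sphere 0 1"
  have cont_ip: "continuous_on S (\<lambda>x :: real^'n. ip (($) x) (($) x))"
    "continuous_on S (\<lambda>x :: real^'n. ip (($) x) (\<lambda>_. c))"
    "continuous_on S (\<lambda>x :: real^'n. dform (($) x) (($) x))" for S c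
    unfolding ip_def dform_def by (intro continuous_intros; simp)+
  have "closed {x :: real^'n. ip (($) x) (\<lambda>_. 1) = 0}"
    by (rule closed_Collect_eq) (auto intro: cont_ip)
  then have "compact K"
    unfolding K_def by (intro closed_Int_compact) auto
  obtain a b :: 'n where "a \<noteq> b"
  proof -
    obtain a b :: 'n where "{a, b} \<subseteq> UNIV" "card {a, b} = 2"
      using card_ge_2 obtain_subset_with_card_n[of 2 "UNIV :: 'n set"] by (metis card_2_iff)
    then show ?thesis
      using that by (metis card_2_iff doubleton_eq_iff insert_absorb2)
  qed
  \<comment> \<open>A nonzero vector of weighted mean zero: swapping the two masses makes its
    entries cancel. The existence of two distinct nodes enters here.\<close>
  define z :: "real^'n" where "z = (\<chi> i. if i = a then M b else if i = b then - M a else 0)"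
  have "z \<noteq> 0"
    using M_pos[of b] by (auto simp: z_def vec_eq_iff intro!: exI[of _ a])
  moreover have "ip (($) z) (\<lambda>_. 1) = 0"
  proof -
    have "ip (($) z) (\<lambda>_. 1)
        = (\<Sum>i\<in>UNIV. (if i = a then M a * M b else 0) - (if i = b then M b * M a else 0))"
      unfolding ip_def using \<open>a \<noteq> b\<close> by (intro sum.cong) (auto simp: z_def)
    then show ?thesis by (simp add: sum_subtractf)
  qed
  moreover have nth_scale: "($) (s *s x) = (\<lambda>i. s * x $ i)" for s :: real and x :: "real^'n"
    by auto
  have norm_scale: "norm (s *s x) = \<bar>s\<bar> * norm x" for s and x :: "real^'n"
    by (simp add: scalar_mult_eq_scaleR)
  have scale_ip: "ip (\<lambda>i. s * x i) (\<lambda>i. r * y i) = s * r * ip x y" for s r x y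
    by (simp add: ip_def sum_distrib_left mult_ac)
  have scale_ip1: "ip (\<lambda>i. s * x i) y = s * ip x y" for s x y
    by (simp add: ip_def sum_distrib_left mult_ac)
  have scale_dform: "dform (\<lambda>i. s * x i) (\<lambda>i. s * x i) = s * s * dform x x" for s x
    by (simp add: dform_def sum_distrib_left right_diff_distrib[symmetric] mult_ac)
  ultimately have "inverse (norm z) *s z \<in> K"
    by (simp add: K_def nth_scale norm_scale scale_ip1)
  then have "K \<noteq> {}" by blast
  have pos: "ip (($) x) (($) x) > 0" if "x \<noteq> 0" for x :: "real^'n"
    using that ip_self_pos by (metis vec_eq_iff zero_index)
  have "continuous_on K (\<lambda>x. dform (($) x) (($) x) / ip (($) x) (($) x))"
  proof (intro continuous_on_divide cont_ip ballI)
    fix x assume "x \<in> K"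
    then have "x \<noteq> 0" by (auto simp: K_def)
    then show "ip (($) x) (($) x) \<noteq> 0" using pos by fastforce
  qed
  then obtain x0 where x0: "x0 \<in> K" and
    min: "\<And>y. y \<in> K \<Longrightarrow> dform (($) x0) (($) x0) / ip (($) x0) (($) x0)
        \<le> dform (($) y) (($) y) / ip (($) y) (($) y)"
    using continuous_attains_inf[OF \<open>compact K\<close> \<open>K \<noteq> {}\<close>] by blast
  define nu where "nu = dform (($) x0) (($) x0) / ip (($) x0) (($) x0)"
  have "x0 \<noteq> 0" and x0_mean: "ip (($) x0) (\<lambda>_. 1) = 0"
    using x0 by (auto simp: K_def)
  have nu_x0: "dform (($) x0) (($) x0) = nu * ip (($) x0) (($) x0)"
    using pos[OF \<open>x0 \<noteq> 0\<close>] by (simp add: nu_def)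
  have ray: "nu * ip (($) y) (($) y) \<le> dform (($) y) (($) y)"
    if "ip (($) y) (\<lambda>_. 1) = 0" for y :: "real^'n"
  proof (cases "y = 0")
    case True
    then show ?thesis by (simp add: ip_def dform_def)
  next
    case False
    define u where "u = inverse (norm y) *s y"
    have yu: "($) y = (\<lambda>i. norm y * u $ i)"
      using False by (auto simp: u_def)
    have "u \<in> K"
      using False that by (simp add: K_def u_def nth_scale norm_scale scale_ip1)
    then have "u \<noteq> 0" by (auto simp: K_def)
    from min[OF \<open>u \<in> K\<close>] have "nu * ip (($) u) (($) u) \<le> dform (($) u) (($) u)"
      using pos[OF \<open>u \<noteq> 0\<close>] by (simp add: nu_def[symmetric] pos_le_divide_eq)
    then have "norm y * norm y * (nu * ip (($) u) (($) u))
        \<le> norm y * norm y * dform (($) u) (($) u)"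
      by (intro mult_left_mono) auto
    then show ?thesis
      unfolding yu scale_ip scale_dform by (simp add: mult_ac)
  qed
  \<comment> \<open>Otherwise the form vanishes at \<open>x0\<close>, which is then constant by
    connectedness and zero because its weighted mean is zero.\<close>
  have "nu > 0"
  proof (rule ccontr)
    assume "\<not> nu > 0"
    then have "nu * ip (($) x0) (($) x0) \<le> 0"
      using pos[OF \<open>x0 \<noteq> 0\<close>] by (simp add: mult_nonpos_nonneg)
    then have "dform (($) x0) (($) x0) = 0"
      using nu_x0 dform_self_nonneg[of "($) x0"] by linarith
    then have const: "x0 $ i = x0 $ a" for i
      by (rule dform_self_eq_0D)
    then have "ip (($) x0) (\<lambda>_. 1) = total * x0 $ a"
      unfolding ip_def total_def sum_distrib_right by (metis mult.right_neutral)
    then have "x0 $ a = 0"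
      using x0_mean total_pos by simp
    then show False
      using const \<open>x0 \<noteq> 0\<close> by (simp add: vec_eq_iff)
  qed
  moreover have "?A *v x0 = nu *s x0"
  proof -
    \<comment> \<open>The residual of the eigenvalue equation serves as its own test direction. It
      has weighted mean zero, so \<open>x0 + s *s y\<close> stays admissible, and the first
      variation along it is \<open>2 * ip y y\<close>, which minimality forces to vanish.\<close>
    define y where "y = ?A *v x0 - nu *s x0"
    have ip_y: "ip (($) y) g = dform (($) x0) g - nu * ip (($) x0) g" for g
      unfolding ip_scaled_laplacian[symmetric]
      by (simp add: y_def ip_def sum_distrib_left sum_subtractf algebra_simps)
    have y_mean: "ip (($) y) (\<lambda>_. 1) = 0"
      unfolding ip_y by (simp add: x0_mean)
    have quad: "0 \<le> 2 * s * ip (($) y) (($) y)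
        + s\<^sup>2 * (dform (($) y) (($) y) - nu * ip (($) y) (($) y))" for s
    proof -
      have "ip (($) (x0 + s *s y)) (\<lambda>_. 1) = ip (($) x0) (\<lambda>_. 1) + s * ip (($) y) (\<lambda>_. 1)"
        by (simp add: ip_def sum_distrib_left sum.distrib algebra_simps)
      then have "nu * ip (($) (x0 + s *s y)) (($) (x0 + s *s y))
          \<le> dform (($) (x0 + s *s y)) (($) (x0 + s *s y))"
        by (intro ray) (simp add: x0_mean y_mean)
      moreover have "ip (($) (x0 + s *s y)) (($) (x0 + s *s y))
          = ip (($) x0) (($) x0) + 2 * s * ip (($) x0) (($) y) + s\<^sup>2 * ip (($) y) (($) y)"
        by (simp add: ip_def sum_distrib_left sum.distrib[symmetric] algebra_simps power2_eq_square)
      moreover have "dform (($) (x0 + s *s y)) (($) (x0 + s *s y))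
          = dform (($) x0) (($) x0) + 2 * s * dform (($) x0) (($) y) + s\<^sup>2 * dform (($) y) (($) y)"
      proof -
        have "(\<Sum>i\<in>UNIV. \<Sum>j\<in>UNIV. B i j * ((x0 $ i + s * y $ i) - (x0 $ j + s * y $ j))
              * ((x0 $ i + s * y $ i) - (x0 $ j + s * y $ j)))
          = (\<Sum>i\<in>UNIV. \<Sum>j\<in>UNIV. B i j * (x0 $ i - x0 $ j) * (x0 $ i - x0 $ j)
              + 2 * s * (B i j * (x0 $ i - x0 $ j) * (y $ i - y $ j))
              + s\<^sup>2 * (B i j * (y $ i - y $ j) * (y $ i - y $ j)))"
          by (intro sum.cong refl) algebra
        then show ?thesis
          by (simp add: dform_def sum.distrib sum_distrib_left[symmetric])
      qed
      moreover have cross: "dform (($) x0) (($) y) = ip (($) y) (($) y) + nu * ip (($) x0) (($) y)"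
        using ip_y[of "($) y"] by simp
      ultimately have "nu * (ip (($) x0) (($) x0) + 2 * s * ip (($) x0) (($) y)
            + s\<^sup>2 * ip (($) y) (($) y))
          \<le> nu * ip (($) x0) (($) x0) + 2 * s * (ip (($) y) (($) y) + nu * ip (($) x0) (($) y))
            + s\<^sup>2 * dform (($) y) (($) y)"
        by (simp only: nu_x0 cross)
      then show ?thesis
        by (simp add: algebra_simps)
    qed
    have "ip (($) y) (($) y) = 0"
      using quad by (rule linear_coeff_eq_0)
    then have "y = 0"
      using pos by force
    then show ?thesis by (simp add: y_def)
  qed
  then have "poly (charpoly ?A) nu = 0"
    using \<open>x0 \<noteq> 0\<close> poly_charpoly_eq_0_iff by blast
  moreover have "nu * ip x x \<le> dform x x" if "ip x (\<lambda>_. 1) = 0" for x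
    using ray[of "\<chi> i. x i"] that by (simp add: vec_lambda_beta[abs_def])
  ultimately show ?thesis
    by (rule that)
qed

abbreviation "lam2 \<equiv> second_smallest_eigenvalue (scaled_laplacian M B)"

text \<open>\<open>lam2\<close> is the least nonzero root and the Rayleigh minimum is one of these
  roots, so the Rayleigh inequality passes down to \<open>lam2\<close>.\<close>

lemma lam2_pos: "lam2 > 0"
  and lam2_le_rayleigh: "ip x (\<lambda>_. 1) = 0 \<Longrightarrow> lam2 * ip x x \<le> dform x x"
proof -
  let ?Z = "{x. poly (charpoly (scaled_laplacian M B)) x = 0}"
  obtain nu where nu: "nu > 0" "nu \<in> ?Z"
    and ray: "\<And>x. ip x (\<lambda>_. 1) = 0 \<Longrightarrow> nu * ip x x \<le> dform x x"
    using rayleigh_minimum by auto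
  have eq: "lam2 = Min (?Z - {0})"
    using nu order_0_charpoly_scaled_laplacian scaled_laplacian_eigenvalue_nonneg
    by (intro second_smallest_eigenvalue_eq_Min) auto
  have fin: "finite (?Z - {0})"
    using poly_roots_finite order_0_charpoly_scaled_laplacian(2) by blast
  have "nu \<in> ?Z - {0}" using nu by simp
  then have "lam2 \<in> ?Z - {0}"
    unfolding eq using fin by (intro Min_in) auto
  then show "lam2 > 0"
    using scaled_laplacian_eigenvalue_nonneg by (simp add: order_less_le)
  have "lam2 \<le> nu"
    unfolding eq by (rule Min_le[OF fin \<open>nu \<in> ?Z - {0}\<close>])
  then have "lam2 * ip x x \<le> nu * ip x x"
    using ip_self_nonneg by (rule mult_right_mono)
  also assume "ip x (\<lambda>_. 1) = 0"
  then have "nu * ip x x \<le> dform x x" by (rule ray)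
  finally show "lam2 * ip x x \<le> dform x x" .
qed

subsection \<open>Lyapunov estimate\<close>

definition dev :: "('n \<Rightarrow> real) \<Rightarrow> 'n \<Rightarrow> real" where
  "dev x i = x i - ip x (\<lambda>_. 1) / total"

lemma ip_commute: "ip x y = ip y x"
  by (simp add: ip_def mult_ac)

lemma ip_dev_1: "ip (dev x) (\<lambda>_. c) = 0"
proof -
  define m where "m = ip x (\<lambda>_. 1) / total"
  have dev: "dev x = (\<lambda>i. x i - m)"
    by (simp add: fun_eq_iff dev_def m_def)
  have "ip (dev x) (\<lambda>_. c) = c * (ip x (\<lambda>_. 1) - m * total)"
    unfolding dev ip_def total_def
    by (simp add: sum_distrib_left sum_subtractf algebra_simps)
  moreover have "m * total = ip x (\<lambda>_. 1)"
    using total_pos by (simp add: m_def)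
  ultimately show ?thesis by simp
qed

lemma dform_dev: "dform (dev x) y = dform x y" "dform x (dev y) = dform x y"
  by (simp_all add: dform_def dev_def)

lemma lam2_ip_dev_le: "lam2 * ip (dev x) (dev x) \<le> dform x x"
  using lam2_le_rayleigh[of "dev x"] by (simp add: ip_dev_1 dform_dev)

lemma ip_dev_self_le: "ip (dev x) x \<le> ip x x"
proof -
  have "ip (dev x) x = ip x x - ip x (\<lambda>_. 1) * ip x (\<lambda>_. 1) / total"
    by (simp add: ip_def dev_def sum_distrib_left sum_divide_distrib sum_subtractf algebra_simps)
  then show ?thesis using total_pos by simp
qed

text \<open>Young's inequality node by node. Taking \<open>y\<close> constant 1 treats the forcing,
  taking \<open>y\<close> as the acceleration treats the damping and the cross term.\<close>

lemma ip_le_weighted_squares: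
  assumes "k > 0" "\<And>i. \<bar>z i\<bar> \<le> M i * c * \<bar>y i\<bar>"
  shows "(\<Sum>i\<in>UNIV. x i * z i) \<le> k * ip x x + c\<^sup>2 * ip y y / (4 * k)"
proof -
  have "x i * z i \<le> k * (M i * x i * x i) + c\<^sup>2 * (M i * y i * y i) / (4 * k)" for i
  proof -
    have "x i * z i \<le> \<bar>x i\<bar> * (M i * c * \<bar>y i\<bar>)"
      using assms(2)[of i] by (metis abs_ge_self abs_ge_zero abs_mult mult_left_mono order_trans)
    also have "\<dots> = M i * (\<bar>x i\<bar> * (c * \<bar>y i\<bar>))" by simp
    also have "\<dots> \<le> M i * (k * \<bar>x i\<bar>\<^sup>2 + (c * \<bar>y i\<bar>)\<^sup>2 / (4 * k))"
      using M_pos[of i] assms(1) by (intro mult_left_mono mult_le_weighted_squares) auto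
    also have "\<dots> = k * (M i * x i * x i) + c\<^sup>2 * (M i * y i * y i) / (4 * k)"
      by (simp add: power_mult_distrib power2_eq_square algebra_simps)
    finally show ?thesis .
  qed
  then have "(\<Sum>i\<in>UNIV. x i * z i)
      \<le> (\<Sum>i\<in>UNIV. k * (M i * x i * x i) + c\<^sup>2 * (M i * y i * y i) / (4 * k))"
    by (rule sum_mono)
  then show ?thesis
    by (simp add: ip_def sum.distrib sum_distrib_left sum_divide_distrib)
qed

text \<open>Here \<open>e\<close> is the weight of the cross term in the Lyapunov function; it is twice the decay
  rate \<open>c\<close> of the theorem.\<close>
lemma lyapunov_rate:
  assumes "0 < mu" "mu \<le> L"
  defines "e \<equiv> mu * lam2 / (2 * (lam2 + 4 * L\<^sup>2))"
  shows "0 < e" "e \<le> mu / 2" "e * (1 + L\<^sup>2 / lam2) \<le> mu / 2" "e / lam2 \<le> 1 / (8 * mu)"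
    "4 * e\<^sup>2 \<le> lam2"
proof -
  note l = lam2_pos
  have L: "L > 0" "L\<^sup>2 > 0" "mu\<^sup>2 \<le> L\<^sup>2"
    using assms by (auto intro: power_mono)
  show "0 < e"
    using assms l L by (simp add: e_def add_pos_pos)
  have "lam2 + 4 * L\<^sup>2 > 0" using l L by linarith
  have "e = mu / 2 * (lam2 / (lam2 + 4 * L\<^sup>2))"
    by (simp add: e_def)
  also have "\<dots> \<le> mu / 2 * 1"
    using assms(1) \<open>lam2 + 4 * L\<^sup>2 > 0\<close> L by (intro mult_left_mono) (simp_all add: pos_divide_le_eq)
  finally show le1: "e \<le> mu / 2" by simp
  have "1 + L\<^sup>2 / lam2 = (lam2 + L\<^sup>2) / lam2"
    using l by (simp add: add_divide_distrib)
  then have "e * (1 + L\<^sup>2 / lam2) = mu * (lam2 + L\<^sup>2) / (2 * (lam2 + 4 * L\<^sup>2))"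
    using l by (simp add: e_def)
  also have "\<dots> \<le> mu / 2"
    using assms l L \<open>lam2 + 4 * L\<^sup>2 > 0\<close> by (simp add: field_simps)
  finally show "e * (1 + L\<^sup>2 / lam2) \<le> mu / 2" .
  have "e / lam2 = mu / (2 * (lam2 + 4 * L\<^sup>2))"
    using l by (simp add: e_def)
  also have "\<dots> \<le> mu / (8 * mu\<^sup>2)"
  proof (intro divide_left_mono mult_pos_pos)
    show "8 * mu\<^sup>2 \<le> 2 * (lam2 + 4 * L\<^sup>2)" using l L(3) by simp
  qed (use assms(1) \<open>lam2 + 4 * L\<^sup>2 > 0\<close> in simp_all)
  also have "\<dots> = 1 / (8 * mu)"
    using assms by (simp add: power2_eq_square)
  finally show le2: "e / lam2 \<le> 1 / (8 * mu)" .
  have "e\<^sup>2 / lam2 = e * (e / lam2)"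
    by (simp add: power2_eq_square)
  also have "\<dots> \<le> (mu / 2) * (1 / (8 * mu))"
    using le1 le2 \<open>0 < e\<close> assms l by (intro mult_mono) auto
  also have "\<dots> \<le> 1 / 4" using assms by simp
  finally show "4 * e\<^sup>2 \<le> lam2"
    using l by (simp add: field_simps)
qed

text \<open>Young's inequality with weight \<open>lam2 / 4\<close>: the spectral gap converts the
  deviation into \<open>dform w w\<close>. Half the energy form dominates twice this bound, so the
  Lyapunov function stays comparable to the energy.\<close>

lemma lyapunov_cross_bound:
  assumes "0 < e" "4 * e\<^sup>2 \<le> lam2"
  shows "\<bar>e * ip (dev w) v\<bar> \<le> (ip v v + dform w w) / 4"
proof -
  have "s * (e * ip (dev w) v) \<le> (ip v v + dform w w) / 4" if "\<bar>s\<bar> = 1" for s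
  proof -
    have "(\<Sum>i\<in>UNIV. dev w i * (s * e * M i * v i))
        \<le> (lam2 / 4) * ip (dev w) (dev w) + e\<^sup>2 * ip v v / (4 * (lam2 / 4))"
      using lam2_pos that assms M_pos
      by (intro ip_le_weighted_squares) (auto simp: abs_mult less_imp_le)
    also have "e\<^sup>2 * ip v v / (4 * (lam2 / 4)) = (e\<^sup>2 / lam2) * ip v v" by simp
    also have "\<dots> \<le> (1 / 4) * ip v v"
      using assms lam2_pos ip_self_nonneg[of v] by (intro mult_right_mono) (auto simp: field_simps)
    finally have "(\<Sum>i\<in>UNIV. dev w i * (s * e * M i * v i))
        \<le> (lam2 * ip (dev w) (dev w) + ip v v) / 4" by simp
    also have "\<dots> \<le> (ip v v + dform w w) / 4"
      using lam2_ip_dev_le[of w] by simp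
    finally show ?thesis
      by (simp add: ip_def sum_distrib_left mult_ac)
  qed
  from this[of 1] this[of "-1"] show ?thesis by auto
qed

text \<open>The left side is the time derivative of the Lyapunov function, with \<open>w\<close> the
  frequencies, \<open>v\<close> their derivative, \<open>a\<close> the second derivative and
  \<open>d\<close> the slopes of \<open>f\<close>. The terms \<open>dform w v\<close> cancel. The
  cross term contributes \<open>- e * dform w w\<close>; half of it pays, through the spectral gap,
  for the deviation squares created by forcing and damping.\<close>

lemma lyapunov_dissipation:
  fixes d v w x :: "'n \<Rightarrow> real"
  assumes mu: "0 < mu" "mu \<le> L"
    and d: "\<And>i. - L \<le> d i / M i" "\<And>i. d i / M i \<le> - mu"
    and x: "\<And>i. \<bar>x i\<bar> \<le> M i * C"
  defines "e \<equiv> mu * lam2 / (2 * (lam2 + 4 * L\<^sup>2))"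
    and "a \<equiv> \<lambda>i. (d i * v i + x i - (\<Sum>j\<in>UNIV. B i j * (w i - w j))) / M i"
  shows "ip v a + dform w v + e * (ip (dev v) v + ip (dev w) a)
     \<le> - (e / 2) * (ip v v + dform w w) + total * C\<^sup>2 * (1 / mu + e / lam2)"
proof -
  note e = lyapunov_rate[OF mu, folded e_def]
  have ip_a: "ip u a = (\<Sum>i\<in>UNIV. u i * (d i * v i)) + (\<Sum>i\<in>UNIV. u i * x i) - dform w u" for u
  proof -
    define S where "S i = (\<Sum>j\<in>UNIV. B i j * (w i - w j))" for i
    have "M i * u i * a i = u i * (d i * v i) + u i * x i - u i * S i" for i
    proof -
      have "M i * u i * a i = u i * (M i * a i)" by simp
      also have "M i * a i = d i * v i + x i - S i"
        using M_pos[of i] by (simp add: a_def S_def)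
      finally show ?thesis by (simp add: algebra_simps)
    qed
    then show ?thesis
      unfolding ip_def dform_eq by (simp add: S_def[symmetric] sum.distrib sum_subtractf)
  qed
  have one: "ip (\<lambda>_. 1) (\<lambda>_. 1) = total"
    by (simp add: ip_def total_def)
  have d': "- L * M i \<le> d i" "d i \<le> - mu * M i" for i
    using d[of i] M_pos[of i] by (simp_all add: pos_le_divide_eq pos_divide_le_eq)
  have 1: "(\<Sum>i\<in>UNIV. v i * (d i * v i)) \<le> - mu * ip v v"
  proof -
    have "v i * (d i * v i) \<le> - mu * (M i * v i * v i)" for i
      using mult_right_mono[OF d'(2)[of i], of "v i * v i"] by (simp add: mult_ac)
    then show ?thesis
      unfolding ip_def sum_distrib_left by (intro sum_mono)
  qed
  \<comment> \<open>The weight \<open>mu / 4\<close> leaves three quarters of the damping: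
    \<open>mu / 2\<close> for the cross term and \<open>mu / 4\<close> for the decay of
    \<open>ip v v\<close>.\<close>
  have 2: "(\<Sum>i\<in>UNIV. v i * x i) \<le> mu / 4 * ip v v + total * C\<^sup>2 / mu"
    using ip_le_weighted_squares[of "mu / 4" x C "\<lambda>_. 1" v] mu x by (simp add: one mult.commute)
  have 3: "(\<Sum>i\<in>UNIV. dev w i * x i) \<le> lam2 / 4 * ip (dev w) (dev w) + total * C\<^sup>2 / lam2"
    using ip_le_weighted_squares[of "lam2 / 4" x C "\<lambda>_. 1" "dev w"] lam2_pos x
    by (simp add: one mult.commute)
  have 4: "(\<Sum>i\<in>UNIV. dev w i * (d i * v i))
      \<le> lam2 / 4 * ip (dev w) (dev w) + L\<^sup>2 / lam2 * ip v v"
  proof -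
    have "\<bar>d i * v i\<bar> \<le> M i * L * \<bar>v i\<bar>" for i
    proof -
      have "d i \<le> 0"
        using d'(2)[of i] mu M_pos[of i] by (smt (verit) mult_minus_left mult_pos_pos)
      then have "\<bar>d i\<bar> \<le> M i * L"
        using d'(1)[of i] by (simp add: mult.commute)
      then show ?thesis by (simp add: abs_mult mult_right_mono)
    qed
    then show ?thesis
      using ip_le_weighted_squares[of "lam2 / 4" "\<lambda>i. d i * v i" L v "dev w"] lam2_pos by simp
  qed
  have P: "0 \<le> ip v v" by (rule ip_self_nonneg)
  have "ip (dev v) v + ip (dev w) a
      \<le> ip v v + (lam2 / 2 * ip (dev w) (dev w) + L\<^sup>2 / lam2 * ip v v + total * C\<^sup>2 / lam2 - dform w w)"
    using ip_dev_self_le[of v] 3 4 by (simp add: ip_a dform_dev)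
  also have "\<dots> \<le> (1 + L\<^sup>2 / lam2) * ip v v - dform w w / 2 + total * C\<^sup>2 / lam2"
    using lam2_ip_dev_le[of w] by (simp add: algebra_simps)
  finally have "e * (ip (dev v) v + ip (dev w) a)
      \<le> e * ((1 + L\<^sup>2 / lam2) * ip v v - dform w w / 2 + total * C\<^sup>2 / lam2)"
    using e by (intro mult_left_mono) auto
  also have "\<dots> = (e * (1 + L\<^sup>2 / lam2)) * ip v v - e / 2 * dform w w + total * C\<^sup>2 * (e / lam2)"
    by (simp add: algebra_simps)
  also have "\<dots> \<le> mu / 2 * ip v v - e / 2 * dform w w + total * C\<^sup>2 * (e / lam2)"
    using e(3) P by (intro add_right_mono diff_right_mono mult_right_mono)
  finally have A: "e * (ip (dev v) v + ip (dev w) a)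
      \<le> mu / 2 * ip v v - e / 2 * dform w w + total * C\<^sup>2 * (e / lam2)" .
  have "ip v a + dform w v \<le> - (3 / 4 * mu) * ip v v + total * C\<^sup>2 / mu"
    using 1 2 by (simp add: ip_a)
  moreover have "e / 2 * ip v v \<le> mu / 4 * ip v v"
    using e(2) P by (intro mult_right_mono) auto
  ultimately show ?thesis
    using A by (simp add: algebra_simps)
qed

section \<open>Differentiating the forms along trajectories\<close>

lemma has_real_derivative_ip:
  assumes "\<And>i. (x i has_real_derivative x' i) (at t)" "\<And>i. (y i has_real_derivative y' i) (at t)"
  shows "((\<lambda>s. ip (\<lambda>i. x i s) (\<lambda>i. y i s)) has_real_derivative
    ip x' (\<lambda>i. y i t) + ip (\<lambda>i. x i t) y') (at t)"
  unfolding ip_def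
  by (auto intro!: derivative_eq_intros assms simp: sum.distrib[symmetric] algebra_simps)

lemma has_real_derivative_dform:
  assumes "\<And>i. (x i has_real_derivative x' i) (at t)"
  shows "((\<lambda>s. dform (\<lambda>i. x i s) (\<lambda>i. x i s)) has_real_derivative
    2 * dform (\<lambda>i. x i t) x') (at t)"
proof -
  have "((\<lambda>s. B i j * (x i s - x j s) * (x i s - x j s)) has_real_derivative
      2 * (B i j * (x i t - x j t) * (x' i - x' j))) (at t)" for i j
    by (auto intro!: derivative_eq_intros assms simp: algebra_simps)
  then have "((\<lambda>s. dform (\<lambda>i. x i s) (\<lambda>i. x i s)) has_real_derivative
      (\<Sum>i\<in>UNIV. \<Sum>j\<in>UNIV. 2 * (B i j * (x i t - x j t) * (x' i - x' j))) / 2) (at t)"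
    unfolding dform_def by (intro DERIV_cdivide DERIV_sum)
  then show ?thesis
    by (simp add: dform_def flip: sum_distrib_left)
qed

lemma has_real_derivative_dev:
  assumes "\<And>i. (x i has_real_derivative x' i) (at t)"
  shows "((\<lambda>s. dev (\<lambda>i. x i s) i) has_real_derivative dev x' i) (at t)"
  unfolding dev_def ip_def
  by (auto intro!: derivative_eq_intros assms
      simp: total_pos[THEN less_imp_neq, symmetric] mult.commute)

end

section \<open>Swing dynamics\<close>

locale swing_network = weighted_network M B
  for M :: "'n::finite \<Rightarrow> real" and B :: "'n \<Rightarrow> 'n \<Rightarrow> real" +
  fixes f f' :: "'n \<Rightarrow> real \<Rightarrow> real"
    and xi xi' :: "'n \<Rightarrow> real \<Rightarrow> real"
    and theta omega :: "'n \<Rightarrow> real \<Rightarrow> real"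
    and omega_b :: "real \<Rightarrow> real"
    and mu L :: real
  assumes f_deriv: "(f i has_real_derivative f' i w) (at w)"
    and mu_pos: "mu > 0"
    and f'_bounds: "- L \<le> f' i w / M i \<and> f' i w / M i \<le> - mu"
    and xi_deriv: "t > 0 \<Longrightarrow> (xi i has_real_derivative xi' i t) (at t)"
    and theta_ode: "t > 0 \<Longrightarrow> (theta i has_real_derivative omega i t) (at t)"
    and omega_ode: "t > 0 \<Longrightarrow> (omega i has_real_derivative
      (f i (omega i t) + xi i t - (\<Sum>j\<in>UNIV. B i j * (theta i t - theta j t))) / M i) (at t)"
    and omega_b_ode: "t > 0 \<Longrightarrow> (omega_b has_real_derivative
      ((\<Sum>i\<in>UNIV. f i (omega_b t)) + (\<Sum>i\<in>UNIV. xi i t)) / (\<Sum>i\<in>UNIV. M i)) (at t)"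
begin

lemma mu_le_L: "mu \<le> L"
  using f'_bounds[of undefined 0] by linarith

definition accel :: "'n \<Rightarrow> real \<Rightarrow> real" where
  "accel i t = (f i (omega i t) + xi i t - (\<Sum>j\<in>UNIV. B i j * (theta i t - theta j t))) / M i"

lemma omega_deriv: "t > 0 \<Longrightarrow> (omega i has_real_derivative accel i t) (at t)"
  unfolding accel_def by (rule omega_ode)

lemma accel_deriv:
  assumes "t > 0"
  shows "(accel i has_real_derivative (f' i (omega i t) * accel i t + xi' i t
      - (\<Sum>j\<in>UNIV. B i j * (omega i t - omega j t))) / M i) (at t)"
proof -
  have "((\<lambda>s. f i (omega i s)) has_real_derivative f' i (omega i t) * accel i t) (at t)"
    by (rule DERIV_chain2[OF f_deriv omega_deriv[OF assms]])
  then show ?thesis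
    unfolding accel_def[abs_def]
    by (intro DERIV_cdivide DERIV_diff DERIV_add DERIV_sum DERIV_cmult xi_deriv theta_ode assms)
      (simp_all add: accel_def)
qed

section \<open>Decay of the deviation from the weighted mean\<close>

definition spread :: "real \<Rightarrow> real" where
  "spread t = ip (dev (\<lambda>i. omega i t)) (dev (\<lambda>i. omega i t))"

definition offset :: "real \<Rightarrow> real" where
  "offset t = ip (\<lambda>i. omega i t) (\<lambda>_. 1) / total - omega_b t"

definition rate :: real where "rate = mu * lam2 / (4 * (lam2 + 4 * L\<^sup>2))"

text \<open>This is \<open>4 / lam2\<close> times \<open>2 * total * C\<^sup>2 / mu\<close>, divided
  by \<open>rate\<close>, with one factor \<open>lam2\<close> enlarged to
  \<open>lam2 + 4 * L\<^sup>2\<close>, which produces the square.\<close>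

definition spread_limit :: "real \<Rightarrow> real" where
  "spread_limit C = 32 * total * C\<^sup>2 * (lam2 + 4 * L\<^sup>2)\<^sup>2 / (mu\<^sup>2 * lam2 ^ 3)"

lemma rate_eq: "mu * lam2 / (2 * (lam2 + 4 * L\<^sup>2)) = 2 * rate"
proof -
  have "a / (2 * q) = 2 * (a / (4 * q))" for a q :: real by simp
  then show ?thesis unfolding rate_def .
qed

lemma rate_pos: "rate > 0" and rate_le: "rate \<le> mu / 4"
  using lyapunov_rate(1,2)[OF mu_pos mu_le_L, unfolded rate_eq] by simp_all

text \<open>Dissipation controls \<open>rate * E\<close>, and \<open>E / 4 \<le> V \<le> E\<close>
  turns this into decay of \<open>V\<close>; the spectral gap then gives
  \<open>lam2 * spread \<le> E \<le> 4 * V\<close>.\<close>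

lemma spread_bound:
  assumes "T > 0" and C: "\<And>i t. t \<ge> T \<Longrightarrow> \<bar>xi' i t\<bar> \<le> M i * C"
  obtains \<alpha> where "\<alpha> \<ge> 0" "\<And>t. t \<ge> T \<Longrightarrow> spread t \<le> \<alpha> * exp (- rate * t) + spread_limit C"
proof -
  let ?w = "\<lambda>t i. omega i t" and ?v = "\<lambda>t i. accel i t"
  define b where "b = total * C\<^sup>2 * (1 / mu + 2 * rate / lam2)"
  define E where "E t = ip (?v t) (?v t) + dform (?w t) (?w t)" for t
  define V where "V t = ip (?v t) (?v t) / 2 + dform (?w t) (?w t) / 2
      + 2 * rate * ip (dev (?w t)) (?v t)" for t
  define a where "a t i = (f' i (omega i t) * accel i t + xi' i t
      - (\<Sum>j\<in>UNIV. B i j * (omega i t - omega j t))) / M i" for t i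
  define V' where "V' t = ip (?v t) (a t) + dform (?w t) (?v t)
      + 2 * rate * (ip (dev (?v t)) (?v t) + ip (dev (?w t)) (a t))" for t
  note lyap = lyapunov_rate[OF mu_pos mu_le_L, unfolded rate_eq]
  have V_deriv: "(V has_real_derivative V' t) (at t)" if "t \<ge> T" for t
  proof -
    have "t > 0" using that assms by simp
    have v: "(accel i has_real_derivative a t i) (at t)" for i
      unfolding a_def using \<open>t > 0\<close> by (rule accel_deriv)
    note w = omega_deriv[OF \<open>t > 0\<close>]
    have "(V has_real_derivative (ip (a t) (?v t) + ip (?v t) (a t)) / 2
        + 2 * dform (?w t) (?v t) / 2
        + 2 * rate * (ip (dev (?v t)) (?v t) + ip (dev (?w t)) (a t))) (at t)"
      unfolding V_def[abs_def]
      by (intro DERIV_add DERIV_cdivide DERIV_cmult has_real_derivative_ip has_real_derivative_dform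
          has_real_derivative_dev v w)
    then show ?thesis
      by (simp add: V'_def ip_commute[of "a t"])
  qed
  have cross: "\<bar>2 * rate * ip (dev (?w t)) (?v t)\<bar> \<le> E t / 4" for t
    unfolding E_def using lyap by (intro lyapunov_cross_bound) auto
  have V_le: "V t \<le> E t" and V_ge: "E t / 4 \<le> V t" for t
    using cross[of t] ip_self_nonneg[of "?v t"] dform_self_nonneg[of "?w t"]
    by (auto simp: V_def E_def abs_le_iff)
  have V'_le: "V' t \<le> - rate * V t + b + 0 * exp (- rate * t)" if "t \<ge> T" for t
  proof -
    have "V' t \<le> - (2 * rate / 2) * E t + b"
      unfolding V'_def E_def b_def a_def
      using lyapunov_dissipation[OF mu_pos mu_le_L, of "\<lambda>i. f' i (omega i t)" "\<lambda>i. xi' i t" C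
          "?v t" "?w t", unfolded rate_eq]
      using f'_bounds C that by simp
    also have "\<dots> \<le> - rate * V t + b"
      using V_le[of t] rate_pos by simp
    finally show ?thesis by simp
  qed
  obtain \<alpha> where \<alpha>: "\<alpha> \<ge> 0" "\<And>t. t \<ge> T \<Longrightarrow> V t \<le> \<alpha> * exp (- rate * t) + b / rate"
    using gronwall_decay[of T V V' rate b 0 rate 0, OF V_deriv V'_le rate_pos order_refl]
      assms(1) by auto
  have const: "4 / lam2 * (b / rate) \<le> spread_limit C"
  proof -
    let ?q = "lam2 + 4 * L\<^sup>2"
    have q: "?q > 0" "lam2 \<le> ?q"
      using lam2_pos by (simp_all add: add_pos_nonneg)
    have "1 / mu + 2 * rate / lam2 \<le> 1 / mu + 1 / (8 * mu)"
      using lyap(4) by simp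
    also have "\<dots> \<le> 2 / mu"
      using mu_pos by (simp add: field_simps)
    finally have "b \<le> total * C\<^sup>2 * (2 / mu)"
      unfolding b_def using total_pos by (intro mult_left_mono) auto
    then have "4 / lam2 * (b / rate) \<le> 4 / lam2 * (total * C\<^sup>2 * (2 / mu) / rate)"
      using lam2_pos rate_pos by (intro mult_left_mono divide_right_mono) auto
    also have "\<dots> = 32 * total * C\<^sup>2 * (lam2 * ?q) / (mu\<^sup>2 * lam2 ^ 3)"
      using lam2_pos mu_pos q(1) by (simp add: rate_def field_simps power2_eq_square power3_eq_cube)
    also have "\<dots> \<le> 32 * total * C\<^sup>2 * (?q * ?q) / (mu\<^sup>2 * lam2 ^ 3)"
      using lam2_pos mu_pos q total_pos
      by (intro divide_right_mono mult_left_mono mult_right_mono) auto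
    finally show ?thesis
      by (simp add: spread_limit_def power2_eq_square)
  qed
  show ?thesis
  proof (rule that[of "4 / lam2 * \<alpha>"])
    show "0 \<le> 4 / lam2 * \<alpha>" using \<alpha>(1) lam2_pos by simp
    fix t assume "t \<ge> T"
    have "lam2 * spread t \<le> E t"
      using lam2_ip_dev_le[of "?w t"] ip_self_nonneg[of "?v t"] by (simp add: E_def spread_def)
    then have "spread t \<le> 4 / lam2 * (E t / 4)"
      using lam2_pos by (simp add: pos_le_divide_eq mult.commute)
    also have "\<dots> \<le> 4 / lam2 * (\<alpha> * exp (- rate * t) + b / rate)"
      using lam2_pos by (intro mult_left_mono order_trans[OF V_ge \<alpha>(2)[OF \<open>t \<ge> T\<close>]]) auto
    also have "\<dots> = 4 / lam2 * \<alpha> * exp (- rate * t) + 4 / lam2 * (b / rate)"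
      by (simp add: distrib_left)
    also have "\<dots> \<le> 4 / lam2 * \<alpha> * exp (- rate * t) + spread_limit C"
      using const by simp
    finally show "spread t \<le> 4 / lam2 * \<alpha> * exp (- rate * t) + spread_limit C" .
  qed
qed

section \<open>Offset of the weighted mean from the blended dynamics\<close>

lemma f_diff:
  obtains d where "f i x - f i y = - (M i * d * (x - y))" "mu \<le> d" "d \<le> L"
proof -
  have "\<exists>z. f i x - f i y = (x - y) * f' i z"
  proof (cases x y rule: linorder_cases)
    case less
    then obtain z where "f i y - f i x = (y - x) * f' i z"
      using MVT2[of x y "f i" "f' i"] f_deriv by blast
    then show ?thesis by (intro exI[of _ z]) (simp add: algebra_simps)
  next
    case greater
    then show ?thesis
      using MVT2[of y x "f i" "f' i"] f_deriv by blast
  qed auto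
  then obtain z where z: "f i x - f i y = (x - y) * f' i z" ..
  show ?thesis
  \<comment> \<open>The negated slope from the mean value theorem acts as a damping coefficient per
    unit of inertia.\<close>
  proof (rule that[of "- (f' i z / M i)"])
    show "f i x - f i y = - (M i * - (f' i z / M i) * (x - y))"
      using M_pos[of i] by (simp add: z)
  qed (use f'_bounds[of i z] in auto)
qed

text \<open>Both equations are driven by the same total disturbance, which cancels in the difference
  just as the flows cancel in the sum.\<close>

lemma offset_deriv:
  assumes "t > 0"
  shows "(offset has_real_derivative
    (\<Sum>i\<in>UNIV. f i (omega i t) - f i (omega_b t)) / total) (at t)"
proof -
  have "ip (\<lambda>i. accel i t) (\<lambda>_. 1)
      = (\<Sum>i\<in>UNIV. f i (omega i t) + xi i t - (\<Sum>j\<in>UNIV. B i j * (theta i t - theta j t)))"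
    unfolding ip_def
  proof (intro sum.cong refl)
    fix i
    show "M i * accel i t * 1 = f i (omega i t) + xi i t
        - (\<Sum>j\<in>UNIV. B i j * (theta i t - theta j t))"
      using M_pos[of i] by (simp add: accel_def)
  qed
  also have "\<dots> = (\<Sum>i\<in>UNIV. f i (omega i t)) + (\<Sum>i\<in>UNIV. xi i t)"
    by (simp only: sum_subtractf sum.distrib sum_flow_eq_0)
  finally have flow: "ip (\<lambda>i. accel i t) (\<lambda>_. 1)
      = (\<Sum>i\<in>UNIV. f i (omega i t)) + (\<Sum>i\<in>UNIV. xi i t)" .
  have "((\<lambda>s. ip (\<lambda>i. omega i s) (\<lambda>_. 1)) has_real_derivative ip (\<lambda>i. accel i t) (\<lambda>_. 1)) (at t)"
    unfolding ip_def
    by (auto intro!: derivative_eq_intros omega_deriv assms sum.cong)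
  then have "(offset has_real_derivative ip (\<lambda>i. accel i t) (\<lambda>_. 1) / total
      - ((\<Sum>i\<in>UNIV. f i (omega_b t)) + (\<Sum>i\<in>UNIV. xi i t)) / total) (at t)"
    unfolding offset_def[abs_def] total_def
    by (intro DERIV_diff DERIV_cdivide omega_b_ode assms)
  then show ?thesis
    by (simp add: flow sum_subtractf diff_divide_distrib add_divide_distrib)
qed

text \<open>Although the deviation has weighted mean zero, the damping coefficients differ between
  nodes, so it still drives the offset. Of the damping \<open>2 * mu\<close>, one \<open>mu\<close>
  absorbs this input by Young's inequality and the other remains as decay.\<close>

lemma offset_dissipation:
  "2 * offset t * ((\<Sum>i\<in>UNIV. f i (omega i t) - f i (omega_b t)) / total)
    \<le> - mu * (offset t)\<^sup>2 + L\<^sup>2 / (mu * total) * spread t"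
proof -
  let ?e = "offset t" and ?y = "dev (\<lambda>i. omega i t)"
  have "2 * ?e * (f i (omega i t) - f i (omega_b t))
      \<le> M i * (- mu * ?e\<^sup>2) + L\<^sup>2 / mu * (M i * ?y i * ?y i)" for i
  proof -
    obtain d where d: "f i (omega i t) - f i (omega_b t) = - (M i * d * (omega i t - omega_b t))"
      "mu \<le> d" "d \<le> L"
      by (rule f_diff)
    have sum: "omega i t - omega_b t = ?y i + ?e"
      by (simp add: dev_def offset_def)
    have "2 * ?e * (f i (omega i t) - f i (omega_b t)) = 2 * ?e * - (M i * d * (?y i + ?e))"
      by (simp only: d(1) sum)
    also have "\<dots> = M i * (2 * (- d * ?e * ?y i - d * ?e\<^sup>2))"
      by (simp add: algebra_simps power2_eq_square)
    also have "\<dots> \<le> M i * (- mu * ?e\<^sup>2 + L\<^sup>2 / mu * (?y i)\<^sup>2)"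
    proof (rule mult_left_mono)
      have "- ?e * (d * ?y i) \<le> mu / 2 * (- ?e)\<^sup>2 + (d * ?y i)\<^sup>2 / (4 * (mu / 2))"
        using mu_pos by (intro mult_le_weighted_squares) auto
      also have "(d * ?y i)\<^sup>2 / (4 * (mu / 2)) \<le> L\<^sup>2 * (?y i)\<^sup>2 / (4 * (mu / 2))"
        using d mu_pos unfolding power_mult_distrib
        by (intro divide_right_mono mult_right_mono power_mono) auto
      finally have "- ?e * (d * ?y i) \<le> mu / 2 * ?e\<^sup>2 + L\<^sup>2 / mu * (?y i)\<^sup>2 / 2"
        by simp
      moreover have "mu * ?e\<^sup>2 \<le> d * ?e\<^sup>2"
        using d by (intro mult_right_mono) auto
      ultimately show "2 * (- d * ?e * ?y i - d * ?e\<^sup>2) \<le> - mu * ?e\<^sup>2 + L\<^sup>2 / mu * (?y i)\<^sup>2"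
        by (simp add: mult_ac)
    qed (use M_pos[of i] in auto)
    finally show ?thesis
      by (simp add: algebra_simps power2_eq_square)
  qed
  then have "(\<Sum>i\<in>UNIV. 2 * ?e * (f i (omega i t) - f i (omega_b t)))
      \<le> (\<Sum>i\<in>UNIV. M i * (- mu * ?e\<^sup>2) + L\<^sup>2 / mu * (M i * ?y i * ?y i))"
    by (rule sum_mono)
  then have "2 * ?e * (\<Sum>i\<in>UNIV. f i (omega i t) - f i (omega_b t))
      \<le> total * (- mu * ?e\<^sup>2) + L\<^sup>2 / mu * spread t"
    by (simp only: sum_distrib_left sum_distrib_right sum.distrib total_def spread_def ip_def)
  then have "2 * ?e * (\<Sum>i\<in>UNIV. f i (omega i t) - f i (omega_b t)) / total
      \<le> (total * (- mu * ?e\<^sup>2) + L\<^sup>2 / mu * spread t) / total"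
    using total_pos by (intro divide_right_mono) auto
  then show ?thesis
    using total_pos by (simp add: add_divide_distrib diff_divide_distrib)
qed

lemma offset_bound:
  assumes "T > 0" and "\<And>t. t \<ge> T \<Longrightarrow> spread t \<le> \<alpha> * exp (- rate * t) + X"
  obtains \<beta> where "\<beta> \<ge> 0"
    "\<And>t. t \<ge> T \<Longrightarrow> (offset t)\<^sup>2 \<le> \<beta> * exp (- rate * t) + (L / mu)\<^sup>2 * X / total"
proof -
  let ?D = "L\<^sup>2 / (mu * total)"
  let ?g' = "\<lambda>t. 2 * offset t * ((\<Sum>i\<in>UNIV. f i (omega i t) - f i (omega_b t)) / total)"
  have deriv: "((\<lambda>t. (offset t)\<^sup>2) has_real_derivative ?g' t) (at t)" if "t \<ge> T" for t
    using that assms(1) by (auto intro!: derivative_eq_intros offset_deriv)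
  have le: "?g' t \<le> - mu * (offset t)\<^sup>2 + ?D * X + ?D * \<alpha> * exp (- rate * t)" if "t \<ge> T" for t
  proof -
    have "?D * spread t \<le> ?D * (\<alpha> * exp (- rate * t) + X)"
      using assms(2)[OF that] mu_pos total_pos by (intro mult_left_mono) auto
    then show ?thesis
      using offset_dissipation[of t] by (simp add: distrib_left mult.assoc)
  qed
  have "rate < mu" "rate \<le> mu"
    using rate_le mu_pos by simp_all
  \<comment> \<open>The witness \<beta> for \<open>gronwall_decay\<close>;
    \<open>rate \<le> mu / 4\<close> keeps its denominator positive.\<close>
  then have "?D * \<alpha> \<le> ?D * \<alpha> / (mu - rate) * (mu - rate)" by simp
  from gronwall_decay[of T "\<lambda>t. (offset t)\<^sup>2" ?g', OF deriv le rate_pos \<open>rate \<le> mu\<close> this] assms(1)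
  obtain \<beta> where "\<beta> \<ge> 0"
    "\<And>t. t \<ge> T \<Longrightarrow> (offset t)\<^sup>2 \<le> \<beta> * exp (- rate * t) + ?D * X / mu"
    by (meson less_imp_le)
  moreover have "?D * X / mu = (L / mu)\<^sup>2 * X / total"
    by (simp add: power2_eq_square)
  ultimately show ?thesis
    using that by simp
qed

section \<open>Nodewise bound from deviation and offset\<close>

definition asymptotic_bound :: "real \<Rightarrow> real" where
  "asymptotic_bound C = (1 + L / mu)\<^sup>2 * spread_limit C / Min (range M)"

lemma deviation_bound:
  assumes "T > 0" and C: "\<And>i t. t \<ge> T \<Longrightarrow> \<bar>xi' i t\<bar> \<le> M i * C"
  obtains \<alpha> where "\<alpha> \<ge> 0"
    "\<And>i t. t \<ge> T \<Longrightarrow> (omega i t - omega_b t)\<^sup>2 \<le> \<alpha> * exp (- rate * t) + asymptotic_bound C"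
proof -
  obtain \<alpha> where \<alpha>: "\<alpha> \<ge> 0"
    and spread: "\<And>t. t \<ge> T \<Longrightarrow> spread t \<le> \<alpha> * exp (- rate * t) + spread_limit C"
    using spread_bound[OF assms] by auto
  obtain \<beta> where \<beta>: "\<beta> \<ge> 0" and offset: "\<And>t. t \<ge> T \<Longrightarrow>
      (offset t)\<^sup>2 \<le> \<beta> * exp (- rate * t) + (L / mu)\<^sup>2 * spread_limit C / total"
    using offset_bound[OF assms(1) spread] by auto
  let ?X = "spread_limit C"
  define m where "m = Min (range M)"
  define r where "r = L / mu"
  have r: "r > 0" using mu_pos mu_le_L by (simp add: r_def)
  have m: "m > 0" using M_pos by (simp add: m_def)
  have m_le: "m \<le> M i" for i by (simp add: m_def)
  have "M i \<le> total" for i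
    unfolding total_def using M_pos by (intro member_le_sum) (auto intro: less_imp_le)
  with m_le have m_total: "m \<le> total" by (meson order_trans)
  have X: "?X \<ge> 0"
    using total_pos lam2_pos by (simp add: spread_limit_def)
  show ?thesis
  proof (rule that[of "(1 + r) * (\<alpha> / m) + (1 + 1 / r) * \<beta>"])
    show "0 \<le> (1 + r) * (\<alpha> / m) + (1 + 1 / r) * \<beta>"
      using \<alpha> \<beta> r m by (intro add_nonneg_nonneg mult_nonneg_nonneg) auto
    fix i t assume "t \<ge> T"
    let ?y = "dev (\<lambda>i. omega i t) i" and ?e = "offset t" and ?E = "exp (- rate * t)"
    have "M i * ?y\<^sup>2 \<le> spread t"
    proof -
      have "M i * dev (\<lambda>i. omega i t) i * dev (\<lambda>i. omega i t) i \<le> spread t"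
        unfolding spread_def ip_def using M_pos
        by (intro member_le_sum) (auto simp: mult.assoc less_imp_le)
      then show ?thesis by (simp add: power2_eq_square mult.assoc)
    qed
    moreover have "m * ?y\<^sup>2 \<le> M i * ?y\<^sup>2"
      by (intro mult_right_mono m_le) auto
    ultimately have "?y\<^sup>2 * m \<le> \<alpha> * ?E + ?X"
      using spread[OF \<open>t \<ge> T\<close>] by (simp add: mult.commute)
    then have y: "?y\<^sup>2 \<le> \<alpha> / m * ?E + ?X / m"
      using m by (simp add: field_simps)
    have "r\<^sup>2 * ?X / total \<le> r\<^sup>2 * ?X / m"
      using m m_total X by (intro divide_left_mono) auto
    then have e: "?e\<^sup>2 \<le> \<beta> * ?E + r\<^sup>2 * ?X / m"
      using offset[OF \<open>t \<ge> T\<close>] unfolding r_def by linarith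
    \<comment> \<open>The ratio \<open>r = L / mu\<close> between the two asymptotic levels is the
      optimal Young weight: the constants combine to exactly \<open>(1 + r)\<^sup>2\<close>.\<close>
    have "2 * (?y * ?e) \<le> 2 * (r / 2 * ?y\<^sup>2 + ?e\<^sup>2 / (4 * (r / 2)))"
      using r by (intro mult_left_mono mult_le_weighted_squares) auto
    then have "2 * (?y * ?e) \<le> r * ?y\<^sup>2 + 1 / r * ?e\<^sup>2"
      by (simp add: distrib_left)
    moreover have "omega i t - omega_b t = ?y + ?e"
      by (simp add: dev_def offset_def)
    ultimately have "(omega i t - omega_b t)\<^sup>2 \<le> (1 + r) * ?y\<^sup>2 + (1 + 1 / r) * ?e\<^sup>2"
      by (simp add: power2_sum distrib_right)
    also have "\<dots> \<le> (1 + r) * (\<alpha> / m * ?E + ?X / m)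
        + (1 + 1 / r) * (\<beta> * ?E + r\<^sup>2 * ?X / m)"
      using r y e by (intro add_mono mult_left_mono) auto
    also have "\<dots> = ((1 + r) * (\<alpha> / m) + (1 + 1 / r) * \<beta>) * ?E
        + ((1 + r) + (1 + 1 / r) * r\<^sup>2) * (?X / m)"
      by (simp add: algebra_simps add_divide_distrib)
    also have "(1 + r) + (1 + 1 / r) * r\<^sup>2 = (1 + r)\<^sup>2"
      using r by (simp add: field_simps power2_eq_square)
    finally show "(omega i t - omega_b t)\<^sup>2
        \<le> ((1 + r) * (\<alpha> / m) + (1 + 1 / r) * \<beta>) * ?E + asymptotic_bound C"
      by (simp add: asymptotic_bound_def m_def r_def)
  qed
qed

lemma asymptotic_bound_nonneg: "asymptotic_bound C \<ge> 0"
  using M_pos total_pos lam2_pos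
  by (simp add: asymptotic_bound_def spread_limit_def less_imp_le)

lemma asymptotic_bound_eq:
  "asymptotic_bound C = 32 * total * (1 + L / mu)\<^sup>2 / (Min (range M) * mu\<^sup>2)
    * C\<^sup>2 * (lam2 + 4 * L\<^sup>2)\<^sup>2 / lam2 ^ 3"
  unfolding asymptotic_bound_def spread_limit_def by (simp add: mult_ac)

text \<open>The differential equations hold only for positive times, so the decay estimate starts at
  time 1; the initial interval is covered by continuity on a compact set.\<close>

lemma deviation_bound_from_0:
  assumes cont: "\<And>i. continuous_on {0..} (omega i)" "continuous_on {0..} omega_b"
    and C: "\<And>i t. t > 0 \<Longrightarrow> \<bar>xi' i t\<bar> \<le> M i * C"
  shows "\<exists>\<alpha>>0. \<forall>t>0. \<forall>i. (omega i t - omega_b t)\<^sup>2 \<le> \<alpha> * exp (- rate * t) + asymptotic_bound C"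
proof -
  obtain \<alpha> where \<alpha>: "\<alpha> \<ge> 0" "\<And>i t. t \<ge> 1 \<Longrightarrow>
      (omega i t - omega_b t)\<^sup>2 \<le> \<alpha> * exp (- rate * t) + asymptotic_bound C"
    using deviation_bound[of 1 C] C by auto
  have "\<exists>b. \<forall>t\<in>{0..1}. (omega i t - omega_b t)\<^sup>2 \<le> b" for i
  proof -
    have "continuous_on {0..1} (\<lambda>t. (omega i t - omega_b t)\<^sup>2)"
      by (intro continuous_intros continuous_on_subset[OF cont(1)] continuous_on_subset[OF cont(2)]) auto
    then show ?thesis
      using continuous_attains_sup[of "{0..1 :: real}"] by fastforce
  qed
  then obtain b where b: "\<And>i t. t \<in> {0..1} \<Longrightarrow> (omega i t - omega_b t)\<^sup>2 \<le> b i"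
    by metis
  define \<beta> where "\<beta> = Max (range b)"
  have b_le: "b i \<le> \<beta>" for i by (simp add: \<beta>_def)
  have "\<beta> \<ge> 0"
    using b_le b[of 0] by (meson atLeastAtMost_iff order_refl order_trans zero_le_one zero_le_power2)
  show ?thesis
  \<comment> \<open>The factor \<open>exp rate\<close> offsets the decay up to time 1, and the
    summand 1 makes the constant strictly positive.\<close>
  proof (intro exI[of _ "\<alpha> + \<beta> * exp rate + 1"] conjI allI impI)
    show "\<alpha> + \<beta> * exp rate + 1 > 0"
      using \<alpha>(1) \<open>\<beta> \<ge> 0\<close> by (intro add_nonneg_pos) auto
    fix t i assume "(t::real) > 0"
    have split: "(\<alpha> + \<beta> * exp rate + 1) * exp (- rate * t)
        = \<alpha> * exp (- rate * t) + \<beta> * exp (rate * (1 - t)) + exp (- rate * t)"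
      by (simp add: distrib_right right_diff_distrib mult.assoc flip: exp_add)
    show "(omega i t - omega_b t)\<^sup>2
        \<le> (\<alpha> + \<beta> * exp rate + 1) * exp (- rate * t) + asymptotic_bound C"
    proof (cases "t \<ge> 1")
      case True
      have "0 \<le> \<beta> * exp (rate * (1 - t))" "0 \<le> exp (- rate * t)"
        using \<open>\<beta> \<ge> 0\<close> by simp_all
      then show ?thesis
        using \<alpha>(2)[OF True, of i] unfolding split by linarith
    next
      case False
      then have "(omega i t - omega_b t)\<^sup>2 \<le> \<beta>"
        using b[of t i] b_le[of i] \<open>t > 0\<close> by simp
      also have "\<beta> * 1 \<le> \<beta> * exp (rate * (1 - t))"
        using \<open>\<beta> \<ge> 0\<close> rate_pos False by (intro mult_left_mono) auto
      then have "\<beta> \<le> \<beta> * exp (rate * (1 - t))" by simp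
      finally have "(omega i t - omega_b t)\<^sup>2 \<le> \<beta> * exp (rate * (1 - t))" .
      moreover have "0 \<le> \<alpha> * exp (- rate * t)" "0 \<le> exp (- rate * t)"
        using \<alpha>(1) by simp_all
      ultimately show ?thesis
        using asymptotic_bound_nonneg[of C] unfolding split by linarith
    qed
  qed
qed

text \<open>The derivative need never fall below \<open>C\<close> itself, but for each
  \<open>D > C\<close> it is eventually below \<open>D\<close>, and the decay estimate can start
  there. Continuity of the bound then lets \<open>D\<close> tend to \<open>C\<close>.\<close>

lemma Limsup_deviation_le:
  assumes C: "\<And>i. Limsup at_top (\<lambda>t. ereal (\<bar>xi' i t\<bar> / M i)) \<le> ereal C"
  shows "Limsup at_top (\<lambda>t. ereal ((omega i t - omega_b t)\<^sup>2)) \<le> ereal (asymptotic_bound C)"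
proof -
  let ?l = "Limsup at_top (\<lambda>t. ereal ((omega i t - omega_b t)\<^sup>2))"
  have le: "?l \<le> ereal (asymptotic_bound D)" if "D > C" for D
  proof -
    have "\<forall>\<^sub>F t in at_top. \<bar>xi' j t\<bar> / M j < D" for j
    proof -
      have "Limsup at_top (\<lambda>t. ereal (\<bar>xi' j t\<bar> / M j)) < ereal D"
        using C[of j] that by (simp add: order_le_less_trans)
      from Limsup_lessD[OF this] show ?thesis by simp
    qed
    then have "\<forall>\<^sub>F t in at_top. \<forall>j. \<bar>xi' j t\<bar> / M j < D"
      by (rule eventually_all_finite)
    then have "\<forall>\<^sub>F t in at_top. t > 0 \<and> (\<forall>j. \<bar>xi' j t\<bar> / M j < D)"
      using eventually_gt_at_top[of "0::real"] by eventually_elim simp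
    then obtain T0 where T0: "\<And>t. t \<ge> T0 \<Longrightarrow> t > 0 \<and> (\<forall>j. \<bar>xi' j t\<bar> / M j < D)"
      by (auto simp: eventually_at_top_linorder)
    then have "T0 > 0" by blast
    moreover have "\<bar>xi' j t\<bar> \<le> M j * D" if "t \<ge> T0" for j t
    proof -
      have "\<bar>xi' j t\<bar> / M j < D"
        using T0[OF that] by simp
      then show ?thesis
        using M_pos[of j] by (simp add: pos_divide_less_eq mult.commute)
    qed
    ultimately obtain \<alpha> where "\<And>j t. t \<ge> T0 \<Longrightarrow>
        (omega j t - omega_b t)\<^sup>2 \<le> \<alpha> * exp (- rate * t) + asymptotic_bound D"
      using deviation_bound[of T0 D] by blast
    then have "?l \<le> Limsup at_top (\<lambda>t. ereal (\<alpha> * exp (- rate * t) + asymptotic_bound D))"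
      by (intro Limsup_mono eventually_at_top_linorderI[of T0]) simp
    also have "\<dots> = ereal (asymptotic_bound D)"
    proof (rule lim_imp_Limsup)
      have "filterlim (\<lambda>t. - rate * t) at_bot at_top"
        by (rule filterlim_tendsto_neg_mult_at_bot[OF tendsto_const _ filterlim_ident])
          (use rate_pos in simp)
      then have "((\<lambda>t. exp (- rate * t)) \<longlongrightarrow> 0) at_top"
        by (rule filterlim_compose[OF exp_at_bot])
      then have "((\<lambda>t. \<alpha> * exp (- rate * t) + asymptotic_bound D)
          \<longlongrightarrow> \<alpha> * 0 + asymptotic_bound D) at_top"
        by (intro tendsto_intros)
      then show "((\<lambda>t. ereal (\<alpha> * exp (- rate * t) + asymptotic_bound D))
          \<longlongrightarrow> ereal (asymptotic_bound D)) at_top"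
        by simp
    qed simp
    finally show ?thesis .
  qed
  have "(asymptotic_bound \<longlongrightarrow> asymptotic_bound C) (at_right C)"
    unfolding asymptotic_bound_eq by (intro tendsto_intros) (use lam2_pos in simp)
  then have "((\<lambda>D. ereal (asymptotic_bound D)) \<longlongrightarrow> ereal (asymptotic_bound C)) (at_right C)"
    by simp
  then show ?thesis
    by (rule tendsto_lowerbound) (auto intro: eventually_at_right_less[THEN eventually_mono] le)
qed

end

theorem theorem5p1:
  fixes M :: "'n::finite \<Rightarrow> real"
    and f f' :: "'n \<Rightarrow> real \<Rightarrow> real"
    and B :: "'n \<Rightarrow> 'n \<Rightarrow> real"
    and xi xi' :: "'n \<Rightarrow> real \<Rightarrow> real"
    and theta omega :: "'n \<Rightarrow> real \<Rightarrow> real"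
    and omega_b :: "real \<Rightarrow> real"
    and mu L :: real
  assumes N2: "CARD('n) \<ge> 2"
    and M_pos: "\<And>i. M i > 0"
    and B_sym: "\<And>i j. B i j = B j i"
    and B_nonneg: "\<And>i j. B i j \<ge> 0"
    and B_irrefl: "\<And>i. B i i = 0"
    and connected: "\<And>i j. (i, j) \<in> {(i, j). B i j > 0}\<^sup>*"
    and f0: "\<And>i. f i 0 = 0"
    and f_deriv: "\<And>i w. (f i has_real_derivative f' i w) (at w)"
    and f'_cont: "\<And>i. continuous_on UNIV (f' i)"
    and mu_pos: "mu > 0" and L_pos: "L > 0"
    and f'_bounds: "\<And>i w. - L \<le> f' i w / M i \<and> f' i w / M i \<le> - mu"
    and xi_deriv: "\<And>i t. t > 0 \<Longrightarrow> (xi i has_real_derivative xi' i t) (at t)"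
    and xi'_cont: "\<And>i. continuous_on {0<..} (xi' i)"
    and xi_jump: "\<And>i. \<exists>l. (xi i \<longlongrightarrow> l) (at_right 0)"
    and theta_cont: "\<And>i. continuous_on {0..} (theta i)"
    and omega_cont: "\<And>i. continuous_on {0..} (omega i)"
    and theta_ode: "\<And>i t. t > 0 \<Longrightarrow> (theta i has_real_derivative omega i t) (at t)"
    and omega_ode: "\<And>i t. t > 0 \<Longrightarrow>
           (omega i has_real_derivative
              (f i (omega i t) + xi i t - (\<Sum>j\<in>UNIV. B i j * (theta i t - theta j t))) / M i) (at t)"
    and omega_b_cont: "continuous_on {0..} omega_b"
    and omega_b_init: "omega_b 0 = (\<Sum>i\<in>UNIV. M i * omega i 0) / (\<Sum>i\<in>UNIV. M i)"
    and omega_b_ode: "\<And>t. t > 0 \<Longrightarrow>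
           (omega_b has_real_derivative
              ((\<Sum>i\<in>UNIV. f i (omega_b t)) / real CARD('n) + (\<Sum>i\<in>UNIV. xi i t) / real CARD('n))
              / ((\<Sum>i\<in>UNIV. M i) / real CARD('n))) (at t)"
  shows
    "let N = real CARD('n);
         Mb = (\<Sum>i\<in>UNIV. M i) / N;
         lam2 = second_smallest_eigenvalue (scaled_laplacian M B);
         K = 32 * N * Mb * (1 + L / mu)^2 / (Min (range M) * mu^2);
         c = mu * lam2 / (4 * (lam2 + 4 * L^2))
     in ((\<forall>i. bdd_above ((\<lambda>t. \<bar>xi' i t\<bar> / M i) ` {0<..})) \<longrightarrow>
           (let C = Max (range (\<lambda>i. SUP t\<in>{0<..}. \<bar>xi' i t\<bar> / M i))
            in \<exists>\<alpha>>0. \<forall>t>0.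
                 Max (range (\<lambda>i. (omega i t - omega_b t)^2))
                   \<le> \<alpha> * exp (- c * t) + K * C^2 * (lam2 + 4 * L^2)^2 / lam2^3))
      \<and> (let Clim = Max (range (\<lambda>i. Limsup at_top (\<lambda>t. ereal (\<bar>xi' i t\<bar> / M i))))
          in Clim < \<infinity> \<longrightarrow>
             Max (range (\<lambda>i. Limsup at_top (\<lambda>t. ereal ((omega i t - omega_b t)^2))))
               \<le> ereal (K * (real_of_ereal Clim)^2 * (lam2 + 4 * L^2)^2 / lam2^3))"
proof -
  let ?N = "real CARD('n)"
  have blended: "(omega_b has_real_derivative
      ((\<Sum>i\<in>UNIV. f i (omega_b t)) + (\<Sum>i\<in>UNIV. xi i t)) / (\<Sum>i\<in>UNIV. M i)) (at t)"
    if "t > 0" for t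
  proof -
    have "((\<Sum>i\<in>UNIV. f i (omega_b t)) / ?N + (\<Sum>i\<in>UNIV. xi i t) / ?N) / ((\<Sum>i\<in>UNIV. M i) / ?N)
        = ((\<Sum>i\<in>UNIV. f i (omega_b t)) + (\<Sum>i\<in>UNIV. xi i t)) / (\<Sum>i\<in>UNIV. M i)"
      by (simp flip: add_divide_distrib)
    then show ?thesis
      using omega_b_ode[OF that] by (simp only:)
  qed
  interpret swing_network M B f f' xi xi' theta omega omega_b mu L
    by unfold_locales (fact N2 M_pos B_sym B_nonneg connected f_deriv mu_pos f'_bounds xi_deriv
        theta_ode omega_ode blended)+
  \<comment> \<open>The number of nodes cancels, as \<open>N * Mb\<close> is the total
    inertia.\<close>
  have bound_eq: "32 * ?N * ((\<Sum>i\<in>UNIV. M i) / ?N) * (1 + L / mu)\<^sup>2 / (Min (range M) * mu\<^sup>2)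
      * C\<^sup>2 * (lam2 + 4 * L\<^sup>2)\<^sup>2 / lam2 ^ 3 = asymptotic_bound C" for C
    unfolding asymptotic_bound_eq total_def by simp
  have 1: "\<exists>\<alpha>>0. \<forall>t>0. Max (range (\<lambda>i. (omega i t - omega_b t)\<^sup>2))
      \<le> \<alpha> * exp (- rate * t) + asymptotic_bound (Max (range (\<lambda>i. SUP t\<in>{0<..}. \<bar>xi' i t\<bar> / M i)))"
    if bdd: "\<forall>i. bdd_above ((\<lambda>t. \<bar>xi' i t\<bar> / M i) ` {0<..})"
  proof -
    let ?C = "Max (range (\<lambda>i. SUP t\<in>{0<..}. \<bar>xi' i t\<bar> / M i))"
    have "\<bar>xi' i t\<bar> \<le> M i * ?C" if "t > 0" for i t
    proof -
      have "\<bar>xi' i t\<bar> / M i \<le> (SUP t\<in>{0<..}. \<bar>xi' i t\<bar> / M i)"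
        using that bdd by (intro cSUP_upper) auto
      also have "\<dots> \<le> ?C" by (intro Max_ge) auto
      finally show ?thesis
        using M_pos[of i] by (simp add: pos_divide_le_eq mult.commute)
    qed
    from deviation_bound_from_0[OF omega_cont omega_b_cont this] show ?thesis
      by simp
  qed
  have 2: "Max (range (\<lambda>i. Limsup at_top (\<lambda>t. ereal ((omega i t - omega_b t)\<^sup>2))))
      \<le> ereal (asymptotic_bound (real_of_ereal Clim))"
    if "Clim < \<infinity>" and Clim: "Clim = Max (range (\<lambda>i. Limsup at_top (\<lambda>t. ereal (\<bar>xi' i t\<bar> / M i))))"
    for Clim
  proof -
    have le: "Limsup at_top (\<lambda>t. ereal (\<bar>xi' i t\<bar> / M i)) \<le> Clim" for i
      unfolding Clim by (intro Max_ge) auto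
    \<comment> \<open>Together with \<open>Clim < \<infinity>\<close> this makes \<open>Clim\<close>
      a real number, so \<open>real_of_ereal\<close> does not fall back to its default
      value.\<close>
    have "0 \<le> Limsup at_top (\<lambda>t. ereal (\<bar>xi' i t\<bar> / M i))" for i
      using M_pos[of i] by (intro le_Limsup) (auto simp: less_imp_le)
    with le have "0 \<le> Clim" by (meson order_trans)
    with \<open>Clim < \<infinity>\<close> have "Clim = ereal (real_of_ereal Clim)"
      by (cases Clim) auto
    with le have "Limsup at_top (\<lambda>t. ereal (\<bar>xi' i t\<bar> / M i)) \<le> ereal (real_of_ereal Clim)" for i
      by metis
    then show ?thesis
      by (intro Max.boundedI) (auto intro: Limsup_deviation_le)
  qed
  show ?thesis
    unfolding Let_def bound_eq using 1 2 by (auto simp: rate_def)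
qed

end
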